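(* Let $n\geq 3$. The maximum degree $d_{\max}(H(D_n))$ of a vertex of the Hasse diagram $H(D_n)$ of the (strong) Bruhat order of the even hyperoctahedral group $D_n$ is $$d_{\max}(H(D_n))=\left\lfloor \frac{n^2}{2}\right\rfloor+n-1.$$
   Context: $B_n$ is the group of permutations $\pi$ of $\{\pm1,\ldots,\pm n\}$ such that $\pi(-a)=-\pi(a)$ for all $a$. $D_n$ is the subgroup of those $\pi\in B_n$ for which the number of $i\in\{1,\ldots,n\}$ with $\pi(i)<0$ is even. $D_n$ is a Coxeter group with Coxeter generators $s_0=(1,-2)(-1,2)$ and $s_i=(i,i+1)(-i,-i-1)$ for $1\le i\le n-1$ (cycle notation). For a Coxeter system $(W,S)$, $\ell$ denotes the length function with respect to $S$ and $T=\bigcup_{w\in W}wSw^{-1}$ the set of reflections. The (strong) Bruhat order on $W$ is the partial order generated by the relations $tw<w$ for $w\in W$, $t\in T$ with $\ell(tw)<\ell(w)$. The Hasse diagram $H(W)$ is the undirected graph with vertex set $W$ in which two elements are joined by an edge if and only if one covers the other in the Bruhat order. The degree of a vertex is its number of neighbours. *)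

theory Defs
  imports "HOL-Algebra.Group" "HOL-Combinatorics.Permutations"
begin

text \<open>
  The next group of definitions is meant for a Coxeter system \<open>(G, S)\<close>. The generators are
  involutions there, so words over \<open>S\<close> itself (without inverses) suffice for the length.
\<close>

definition cox_length :: "('a, 'b) monoid_scheme \<Rightarrow> 'a set \<Rightarrow> 'a \<Rightarrow> nat" where
  "cox_length G S w =
     (LEAST k. \<exists>xs. length xs = k \<and> set xs \<subseteq> S \<and> foldr (\<lambda>x y. x \<otimes>\<^bsub>G\<^esub> y) xs \<one>\<^bsub>G\<^esub> = w)"

definition reflections :: "('a, 'b) monoid_scheme \<Rightarrow> 'a set \<Rightarrow> 'a set" where
  "reflections G S = (\<Union>w\<in>carrier G. {w \<otimes>\<^bsub>G\<^esub> s \<otimes>\<^bsub>G\<^esub> inv\<^bsub>G\<^esub> w |s. s \<in> S})"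

definition bruhat_step :: "('a, 'b) monoid_scheme \<Rightarrow> 'a set \<Rightarrow> ('a \<times> 'a) set" where
  "bruhat_step G S =
     {(t \<otimes>\<^bsub>G\<^esub> w, w) |t w. t \<in> reflections G S \<and> w \<in> carrier G \<and>
        cox_length G S (t \<otimes>\<^bsub>G\<^esub> w) < cox_length G S w}"

text \<open>
  The strict Bruhat order. Every generating relation increases the length, so the transitive
  closure is irreflexive.
\<close>

definition bruhat_less :: "('a, 'b) monoid_scheme \<Rightarrow> 'a set \<Rightarrow> ('a \<times> 'a) set" where
  "bruhat_less G S = (bruhat_step G S)\<^sup>+"

definition bruhat_covers :: "('a, 'b) monoid_scheme \<Rightarrow> 'a set \<Rightarrow> 'a \<Rightarrow> 'a \<Rightarrow> bool" where
  "bruhat_covers G S v u \<longleftrightarrow> (u, v) \<in> bruhat_less G S \<and>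
     \<not> (\<exists>x\<in>carrier G. (u, x) \<in> bruhat_less G S \<and> (x, v) \<in> bruhat_less G S)"

definition hasse_edges :: "('a, 'b) monoid_scheme \<Rightarrow> 'a set \<Rightarrow> 'a set set" where
  "hasse_edges G S =
     {{u, v} |u v. u \<in> carrier G \<and> v \<in> carrier G \<and>
        (bruhat_covers G S v u \<or> bruhat_covers G S u v)}"

definition hasse_degree :: "('a, 'b) monoid_scheme \<Rightarrow> 'a set \<Rightarrow> 'a \<Rightarrow> nat" where
  "hasse_degree G S w = card {v \<in> carrier G. {w, v} \<in> hasse_edges G S}"

definition hasse_max_degree :: "('a, 'b) monoid_scheme \<Rightarrow> 'a set \<Rightarrow> nat" where
  "hasse_max_degree G S = Max (hasse_degree G S ` carrier G)"

text \<open>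
  Signed permutations are functions on all integers which, by the definition of
  \<open>permutes\<close>, are the identity outside \<open>{\<plusminus>1, \<dots>, \<plusminus>n}\<close>.
\<close>

definition signed_perms :: "nat \<Rightarrow> (int \<Rightarrow> int) set" where
  "signed_perms n =
     {\<pi>. \<pi> permutes {a. 1 \<le> \<bar>a\<bar> \<and> \<bar>a\<bar> \<le> int n} \<and>
        (\<forall>a. 1 \<le> \<bar>a\<bar> \<and> \<bar>a\<bar> \<le> int n \<longrightarrow> \<pi> (- a) = - \<pi> a)}"

definition even_signed_perms :: "nat \<Rightarrow> (int \<Rightarrow> int) set" where
  "even_signed_perms n =
     {\<pi> \<in> signed_perms n. even (card {i \<in> {1..int n}. \<pi> i < 0})}"

definition D_group :: "nat \<Rightarrow> (int \<Rightarrow> int) monoid" where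
  "D_group n = \<lparr>carrier = even_signed_perms n, monoid.mult = (\<circ>), one = id\<rparr>"

definition D_gen :: "nat \<Rightarrow> int \<Rightarrow> int" where
  "D_gen i =
     (if i = 0 then transpose 1 (- 2) \<circ> transpose (- 1) 2
      else transpose (int i) (int i + 1) \<circ> transpose (- int i) (- int i - 1))"

definition D_gens :: "nat \<Rightarrow> (int \<Rightarrow> int) set" where
  "D_gens n = D_gen ` {0..<n}"

end

theory Submission
  imports Defs
begin


text \<open>
  Draw a signed permutation \<open>w\<close> as the \<open>2 n\<close> points \<open>(k, w k)\<close>, a configuration symmetric about the
  origin. A reflection of \<open>D\<^sub>n\<close> multiplied on the right interchanges the values at two positions
  \<open>i\<close>, \<open>j\<close> with \<open>\<bar>i\<bar> \<noteq> \<bar>j\<bar>\<close>, and simultaneously those at \<open>- i\<close>, \<open>- j\<close>. Twice the Coxeter length counts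
  the inversions among positions of different absolute value, and it changes by exactly two under such
  an interchange when the box spanned by the points at \<open>i\<close> and \<open>j\<close> is empty, meaning that it contains
  no point except possibly those at \<open>- i\<close> and \<open>- j\<close>. If the box does contain another point, the
  interchange factors into three that pass through intermediate elements of the Bruhat order. Hence the neighbours of \<open>w\<close> in the Hasse
  diagram are exactly the \<open>w \<circ> srefl i j\<close> with an empty box (lemma \<open>hasse_neighbours\<close>), and the
  degree is at most the number of empty pairs \<open>{i, j}\<close> up to the symmetry
  \<open>{i, j} \<mapsto> {- i, - j}\<close>. The theorem thus becomes an extremal problem about empty boxes in symmetric
  point sets.

  The upper bound \<open>f n = \<lfloor>n\<^sup>2/2\<rfloor> + n - 1\<close> for this number is proved by induction on \<open>n\<close>, deleting points;
  a deletion destroys no empty box that avoids the deleted points. If some point has at most \<open>n\<close>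
  neighbours, deleting it with its antipode suffices, because \<open>f n - f (n - 1) \<ge> n\<close>. Otherwise let
  \<open>x\<close> be the leftmost point and \<open>y\<close> its rightmost neighbour, and delete both with their antipodes;
  as \<open>f n - f (n - 2) = 2 n\<close>, at most \<open>2 n\<close> orbits may be lost, which asks for few common neighbours
  of \<open>x\<close> and \<open>y\<close>. By the choice of \<open>y\<close> a common neighbour lies horizontally between \<open>x\<close> and \<open>y\<close>, hence
  above both or below both, and two of them on the same side must be antipodal, or else one would lie
  in a box of the other. So there are at most three, and the loss is at most \<open>2 n\<close> except in one
  configuration, where it is \<open>2 n + 1\<close>. In that configuration, if \<open>n \<ge> 5\<close>, either the deletion creates a
  new empty box, which pays for the excess, or some point has at most \<open>n\<close> neighbours after all (lemma
  \<open>exceptional_pair\<close>).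

  The bound is attained by a signed permutation whose outer points form two decreasing blocks, one at
  the lower left and one at the upper right, separated by a decreasing chain of about \<open>n\<close> points around
  the origin: every outer point spans an empty box with every point of the chain.
\<close>

section \<open>Empty boxes in symmetric point configurations\<close>

definition strictly_between :: "int \<Rightarrow> int \<Rightarrow> int \<Rightarrow> bool" where
  "strictly_between a b c \<longleftrightarrow> a < b \<and> b < c \<or> c < b \<and> b < a"

text \<open>
  The points of the configuration are \<open>(k, w k)\<close> for \<open>k \<in> A\<close>. Points at \<open>- i\<close> and \<open>- j\<close> are tolerated
  inside the box of \<open>i\<close> and \<open>j\<close>: passing through the point at \<open>- i\<close> would require the interchange of \<open>i\<close>
  and \<open>- i\<close>, which does not belong to \<open>D\<^sub>n\<close>.
\<close>

definition box_adj :: "int set \<Rightarrow> (int \<Rightarrow> int) \<Rightarrow> int \<Rightarrow> int \<Rightarrow> bool" where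
  "box_adj A w i j \<longleftrightarrow> i \<in> A \<and> j \<in> A \<and> \<bar>i\<bar> \<noteq> \<bar>j\<bar> \<and>
     (\<forall>k\<in>A. \<bar>k\<bar> \<noteq> \<bar>i\<bar> \<longrightarrow> \<bar>k\<bar> \<noteq> \<bar>j\<bar> \<longrightarrow>
        strictly_between i k j \<longrightarrow> \<not> strictly_between (w i) (w k) (w j))"

definition nbrs :: "int set \<Rightarrow> (int \<Rightarrow> int) \<Rightarrow> int \<Rightarrow> int set" where
  "nbrs A w x = {y. box_adj A w x y}"

text \<open>
  The pairs \<open>{i, j}\<close> and \<open>{- i, - j}\<close> define the same reflection, so they are counted once.
\<close>

definition pair_orbit :: "int \<Rightarrow> int \<Rightarrow> int set set" where
  "pair_orbit i j = {{i, j}, {-i, -j}}"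

definition adj_orbits :: "int set \<Rightarrow> (int \<Rightarrow> int) \<Rightarrow> int set set set" where
  "adj_orbits A w = {pair_orbit i j |i j. box_adj A w i j}"

definition odd_config :: "int set \<Rightarrow> (int \<Rightarrow> int) \<Rightarrow> bool" where
  "odd_config A w \<longleftrightarrow> finite A \<and> (\<forall>a\<in>A. - a \<in> A \<and> a \<noteq> 0 \<and> w (- a) = - w a) \<and> inj_on w A"

lemma strictly_between_minus [simp]:
  "strictly_between (- a) (- b) (- c) \<longleftrightarrow> strictly_between a b c"
  by (auto simp: strictly_between_def)

lemma strictly_between_sym: "strictly_between a b c \<longleftrightarrow> strictly_between c b a"
  by (auto simp: strictly_between_def)

lemma box_adj_sym: "box_adj A w i j \<longleftrightarrow> box_adj A w j i"
  by (auto simp: box_adj_def strictly_between_def)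

lemma box_adj_value_flip: "box_adj A (\<lambda>k. - w k) i j \<longleftrightarrow> box_adj A w i j"
  by (simp add: box_adj_def)

lemma box_adj_mem: "box_adj A w i j \<Longrightarrow> i \<in> A \<and> j \<in> A \<and> \<bar>i\<bar> \<noteq> \<bar>j\<bar>"
  by (simp add: box_adj_def)

lemma box_adj_not_between:
  assumes "box_adj A w i j" "k \<in> A" "\<bar>k\<bar> \<noteq> \<bar>i\<bar>" "\<bar>k\<bar> \<noteq> \<bar>j\<bar>" "strictly_between i k j"
  shows "\<not> strictly_between (w i) (w k) (w j)"
  using assms by (simp add: box_adj_def)

lemma box_adj_minus:
  assumes "odd_config A w" "box_adj A w i j"
  shows "box_adj A w (- i) (- j)"
proof -
  have m: "i \<in> A" "j \<in> A" "\<bar>i\<bar> \<noteq> \<bar>j\<bar>" and neg: "\<And>a. a \<in> A \<Longrightarrow> - a \<in> A \<and> w (- a) = - w a"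
    using assms by (auto simp: odd_config_def box_adj_def)
  have "\<not> strictly_between (w (-i)) (w k) (w (-j))"
    if k: "k \<in> A" "\<bar>k\<bar> \<noteq> \<bar>i\<bar>" "\<bar>k\<bar> \<noteq> \<bar>j\<bar>" "strictly_between (-i) k (-j)" for k
  proof -
    have "\<not> strictly_between (w i) (w (-k)) (w j)"
      using box_adj_not_between[OF assms(2), of "-k"] k neg strictly_between_minus[of i "-k" j] by simp
    then show ?thesis using neg m k(1) strictly_between_minus[of "w i" "- w k" "w j"] by simp
  qed
  then show ?thesis using m neg by (simp add: box_adj_def)
qed

lemma box_adj_minus_iff:
  assumes "odd_config A w"
  shows "box_adj A w (- i) (- j) \<longleftrightarrow> box_adj A w i j"
  using box_adj_minus[OF assms, of i j] box_adj_minus[OF assms, of "-i" "-j"] by auto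

lemma box_adj_mono:
  assumes "box_adj A w i j" "B \<subseteq> A" "i \<in> B" "j \<in> B"
  shows "box_adj B w i j"
  using assms by (auto simp: box_adj_def)

lemma odd_config_diff:
  assumes "odd_config A w" "\<And>k. k \<in> S \<Longrightarrow> - k \<in> S"
  shows "odd_config (A - S) w"
  using assms unfolding odd_config_def inj_on_def by (metis Diff_iff finite_Diff minus_minus)

lemma odd_config_value_flip:
  assumes "odd_config A w"
  shows "odd_config A (\<lambda>k. - w k)"
  using assms by (auto simp: odd_config_def inj_on_def)

lemma pair_orbit_sym: "pair_orbit i j = pair_orbit j i"
  by (simp add: pair_orbit_def insert_commute)

lemma pair_orbit_minus: "pair_orbit (- i) (- j) = pair_orbit i j"
  by (auto simp: pair_orbit_def)

lemma pair_orbit_eqD: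
  assumes "pair_orbit i j = pair_orbit k l"
  shows "(i, j) \<in> {(k, l), (l, k), (- k, - l), (- l, - k)}"
proof -
  have "{i, j} \<in> pair_orbit i j" by (simp add: pair_orbit_def)
  then have "{i, j} = {k, l} \<or> {i, j} = {- k, - l}"
    unfolding assms by (simp add: pair_orbit_def)
  then show ?thesis unfolding doubleton_eq_iff by blast
qed

lemma pair_orbit_mem_adj_orbits:
  assumes "odd_config A w"
  shows "pair_orbit i j \<in> adj_orbits A w \<longleftrightarrow> box_adj A w i j"
proof
  assume "pair_orbit i j \<in> adj_orbits A w"
  then obtain k l where kl: "pair_orbit i j = pair_orbit k l" "box_adj A w k l"
    by (auto simp: adj_orbits_def)
  show "box_adj A w i j"
    using pair_orbit_eqD[OF kl(1)] kl(2) box_adj_minus_iff[OF assms, of k l]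
      box_adj_minus_iff[OF assms, of l k] box_adj_sym[of A w k l] by auto
qed (auto simp: adj_orbits_def)

lemma finite_nbrs: "odd_config A w \<Longrightarrow> finite (nbrs A w x)"
  by (rule finite_subset[of _ A]) (auto simp: nbrs_def box_adj_def odd_config_def)

lemma finite_adj_orbits: 
  assumes "odd_config A w" shows "finite (adj_orbits A w)"
proof (rule finite_subset)
  show "adj_orbits A w \<subseteq> (\<lambda>(i, j). pair_orbit i j) ` (A \<times> A)"
    by (auto simp: adj_orbits_def box_adj_def)
  show "finite ((\<lambda>(i, j). pair_orbit i j) ` (A \<times> A))"
    using assms by (simp add: odd_config_def)
qed

lemma card_nbrs_le:
  assumes "odd_config A w" "x \<in> A" "card A = 2 * n"
  shows "card (nbrs A w x) \<le> 2 * n - 2"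
proof -
  have "x \<noteq> - x" "- x \<in> A" "finite A" using assms by (auto simp: odd_config_def)
  moreover have "nbrs A w x \<subseteq> A - {x, - x}" by (auto simp: nbrs_def box_adj_def)
  ultimately show ?thesis
    using assms(2,3) card_mono[of "A - {x, - x}" "nbrs A w x"] by (simp add: card_Diff_subset)
qed

lemma incident_orbit_representative:
  assumes "odd_config A w" "box_adj A w i j" "\<bar>i\<bar> = \<bar>v\<bar> \<or> \<bar>j\<bar> = \<bar>v\<bar>"
  shows "\<exists>z. box_adj A w v z \<and> pair_orbit i j = pair_orbit v z"
proof -
  consider "i = v" | "j = v" | "i = - v" | "j = - v" using assms(3) by linarith
  then show ?thesis
  proof cases
    case 1 then show ?thesis using assms by blast
  next
    case 2 then show ?thesis using assms box_adj_sym pair_orbit_sym by blast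
  next
    case 3
    then have "box_adj A w v (- j)" "pair_orbit i j = pair_orbit v (- j)"
      using box_adj_minus[OF assms(1,2)] pair_orbit_minus[of i j] by auto
    then show ?thesis by blast
  next
    case 4
    then have "box_adj A w v (- i)" "pair_orbit i j = pair_orbit v (- i)"
      using box_adj_minus[OF assms(1,2)] pair_orbit_minus[of i j] box_adj_sym[of A w "- i" "- j"] pair_orbit_sym[of v "- i"] by auto
    then show ?thesis by blast
  qed
qed

lemma card_adj_orbits_remove1:
  assumes oc: "odd_config A w"
  shows "card (adj_orbits A w) \<le> card (adj_orbits (A - {x, - x}) w) + card (nbrs A w x)"
proof -
  let ?B = "A - {x, - x}"
  have "adj_orbits A w \<subseteq> adj_orbits ?B w \<union> pair_orbit x ` nbrs A w x"
  proof
    fix e assume "e \<in> adj_orbits A w"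
    then obtain i j where e: "e = pair_orbit i j" "box_adj A w i j" by (auto simp: adj_orbits_def)
    show "e \<in> adj_orbits ?B w \<union> pair_orbit x ` nbrs A w x"
    proof (cases "\<bar>i\<bar> = \<bar>x\<bar> \<or> \<bar>j\<bar> = \<bar>x\<bar>")
      case False
      then have "box_adj ?B w i j" using e box_adj_mem[OF e(2)] by (intro box_adj_mono[OF e(2)]) auto
      then show ?thesis using e by (auto simp: adj_orbits_def)
    next
      case True
      then have "\<exists>z. box_adj A w x z \<and> pair_orbit i j = pair_orbit x z"
        by (rule incident_orbit_representative[OF oc e(2)])
      then show ?thesis using e by (auto simp: nbrs_def)
    qed
  qed
  then have "card (adj_orbits A w) \<le> card (adj_orbits ?B w \<union> pair_orbit x ` nbrs A w x)"
    by (intro card_mono finite_UnI finite_imageI finite_nbrs[OF oc]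
        finite_adj_orbits[OF odd_config_diff[OF oc]]) auto
  also have "\<dots> \<le> card (adj_orbits ?B w) + card (pair_orbit x ` nbrs A w x)" by (rule card_Un_le)
  also have "\<dots> \<le> card (adj_orbits ?B w) + card (nbrs A w x)"
    using card_image_le[OF finite_nbrs[OF oc], of "pair_orbit x"] by simp
  finally show ?thesis .
qed

text \<open>
  The first part of the union keeps the intersection with \<open>adj_orbits A w\<close>, because a pair that
  becomes empty only through the deletion improves the count; the last part is the at most two
  orbits that join the orbits of \<open>x\<close> and \<open>y\<close> and must not be counted for both.
\<close>

lemma adj_orbits_remove2_subset:
  fixes x y :: int
  assumes oc: "odd_config A w"
  defines "B \<equiv> A - {x, - x, y, - y}"
  shows "adj_orbits A w \<subseteq> (adj_orbits B w \<inter> adj_orbits A w) \<union> (pair_orbit x ` (nbrs A w x \<inter> B)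
    \<union> pair_orbit y ` (nbrs A w y \<inter> B)) \<union> pair_orbit x ` (nbrs A w x \<inter> {y, - y})"
proof
  fix e assume eA: "e \<in> adj_orbits A w"
  then obtain i j where e: "e = pair_orbit i j" "box_adj A w i j" by (auto simp: adj_orbits_def)
  have m: "i \<in> A" "j \<in> A" "\<bar>i\<bar> \<noteq> \<bar>j\<bar>" using box_adj_mem[OF e(2)] by auto
  have inB: "k \<in> B \<longleftrightarrow> k \<in> A \<and> \<bar>k\<bar> \<noteq> \<bar>x\<bar> \<and> \<bar>k\<bar> \<noteq> \<bar>y\<bar>" for k
    by (auto simp: B_def abs_eq_iff)
  consider "\<bar>i\<bar> = \<bar>x\<bar> \<or> \<bar>j\<bar> = \<bar>x\<bar>" | "\<bar>i\<bar> \<noteq> \<bar>x\<bar>" "\<bar>j\<bar> \<noteq> \<bar>x\<bar>" "\<bar>i\<bar> = \<bar>y\<bar> \<or> \<bar>j\<bar> = \<bar>y\<bar>" 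
    | "i \<in> B" "j \<in> B"
    using m inB by blast
  then show "e \<in> (adj_orbits B w \<inter> adj_orbits A w) \<union> (pair_orbit x ` (nbrs A w x \<inter> B)
    \<union> pair_orbit y ` (nbrs A w y \<inter> B)) \<union> pair_orbit x ` (nbrs A w x \<inter> {y, - y})"
  proof cases
    case 1
    then obtain z where z: "box_adj A w x z" "e = pair_orbit x z"
      using incident_orbit_representative[OF oc e(2)] e(1) by blast
    have "z \<in> B \<or> z \<in> {y, - y}" using box_adj_mem[OF z(1)] by (auto simp: inB abs_eq_iff)
    moreover have "z \<in> nbrs A w x" using z by (simp add: nbrs_def)
    ultimately show ?thesis unfolding z(2) by blast
  next
    case 2
    then obtain z where z: "box_adj A w y z" "e = pair_orbit y z"
      using incident_orbit_representative[OF oc e(2)] e(1) by blast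
    have "(y, z) \<in> {(i, j), (j, i), (-i, -j), (-j, -i)}" using pair_orbit_eqD z(2) e(1) by metis
    then have "z = j \<or> z = i \<or> z = - j \<or> z = - i" by blast
    then have "\<bar>z\<bar> = \<bar>i\<bar> \<or> \<bar>z\<bar> = \<bar>j\<bar>" by (elim disjE) simp_all
    then have "\<bar>z\<bar> \<noteq> \<bar>x\<bar>" using 2(1,2) by (elim disjE) simp_all
    then have "z \<in> B" using box_adj_mem[OF z(1)] by (simp add: inB)
    moreover have "z \<in> nbrs A w y" using z by (simp add: nbrs_def)
    ultimately show ?thesis unfolding z(2) by blast
  next
    case 3
    then have "box_adj B w i j" by (intro box_adj_mono[OF e(2)]) (simp_all add: B_def)
    then show ?thesis using e eA by (auto simp: adj_orbits_def)
  qed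
qed


section \<open>Common neighbours of the leftmost point and its farthest neighbour\<close>

lemma card_two_antipodal_pairs:
  fixes x y :: int
  assumes "x \<noteq> 0" "y \<noteq> 0" "\<bar>x\<bar> \<noteq> \<bar>y\<bar>"
  shows "card {x, - x, y, - y} = 4"
proof -
  have "x \<noteq> - x" "y \<noteq> - y" "x \<noteq> y" "x \<noteq> - y" "- x \<noteq> y" "- x \<noteq> - y" using assms by auto
  then show ?thesis by simp
qed

text \<open>
  Every remaining point is joined to \<open>x\<close> or to \<open>y\<close>, to both (a common neighbour), or to neither.
  With no correction terms the \<open>2 n - 4\<close> remaining points account for one lost orbit each.
\<close>

lemma card_adj_orbits_remove2:
  fixes x y :: int
  assumes oc: "odd_config A w" and card: "card A = 2 * n" and xy: "x \<in> A" "y \<in> A" "\<bar>x\<bar> \<noteq> \<bar>y\<bar>"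
  defines "B \<equiv> A - {x, - x, y, - y}"
  shows "card (adj_orbits A w) + card (B - (nbrs A w x \<union> nbrs A w y)) + 4
    \<le> card (adj_orbits B w \<inter> adj_orbits A w) + 2 * n
        + card (nbrs A w x \<inter> nbrs A w y \<inter> B) + card (nbrs A w x \<inter> {y, - y})"
proof -
  let ?Nx = "nbrs A w x \<inter> B" and ?Ny = "nbrs A w y \<inter> B" and ?m = "nbrs A w x \<inter> {y, - y}"
  let ?E = "adj_orbits B w \<inter> adj_orbits A w"
  have fA: "finite A" using oc by (simp add: odd_config_def)
  have fB: "finite B" using fA by (simp add: B_def)
  have fin: "finite ?Nx" "finite ?Ny" "finite ?m" "finite ?E"
    using fB finite_adj_orbits[OF oc] by auto
  have "- x \<in> A" "- y \<in> A" "x \<noteq> 0" "y \<noteq> 0" using oc xy by (auto simp: odd_config_def)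
  then have sub: "{x, - x, y, - y} \<subseteq> A" and four: "card {x, - x, y, - y} = 4"
    using xy card_two_antipodal_pairs[of x y] by simp_all
  have cB: "card B + 4 = 2 * n"
    using card four card_Diff_subset[OF _ sub] card_mono[OF fA sub] unfolding B_def by simp
  have "card (adj_orbits A w) \<le> card (?E \<union> (pair_orbit x ` ?Nx \<union> pair_orbit y ` ?Ny) \<union> pair_orbit x ` ?m)"
    using adj_orbits_remove2_subset[OF oc, of x y] fin unfolding B_def by (intro card_mono) auto
  also have "\<dots> \<le> card ?E + (card (pair_orbit x ` ?Nx) + card (pair_orbit y ` ?Ny)) + card (pair_orbit x ` ?m)"
    by (intro order_trans[OF card_Un_le] add_mono card_Un_le order_refl)
  also have "\<dots> \<le> card ?E + (card ?Nx + card ?Ny) + card ?m"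
    by (intro add_mono card_image_le fin order_refl)
  finally have 1: "card (adj_orbits A w) \<le> card ?E + (card ?Nx + card ?Ny) + card ?m" .
  have 2: "card ?Nx + card ?Ny = card (?Nx \<union> ?Ny) + card (nbrs A w x \<inter> nbrs A w y \<inter> B)"
    using card_Un_Int[OF fin(1,2)] by (simp add: Int_ac)
  have "?Nx \<union> ?Ny \<subseteq> B" "B - (?Nx \<union> ?Ny) = B - (nbrs A w x \<union> nbrs A w y)" by auto
  then have 3: "card (?Nx \<union> ?Ny) + card (B - (nbrs A w x \<union> nbrs A w y)) = card B"
    using card_Diff_subset[of "?Nx \<union> ?Ny" B] card_mono[OF fB, of "?Nx \<union> ?Ny"] fin by simp
  show ?thesis using 1 2 3 cB by linarith
qed

lemma common_neighbour_location:
  assumes oc: "odd_config A w" and xy: "x \<in> A" "\<forall>a\<in>A. x \<le> a" "box_adj A w x y"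
    and far: "\<forall>j\<in>nbrs A w x. j \<le> y"
    and z: "box_adj A w x z" "\<bar>z\<bar> \<noteq> \<bar>y\<bar>"
  shows "x < z \<and> z < y \<and> (w z > max (w x) (w y) \<or> w z < min (w x) (w y))"
proof -
  have m: "z \<in> A" "\<bar>x\<bar> \<noteq> \<bar>z\<bar>" "y \<in> A" using box_adj_mem[OF z(1)] box_adj_mem[OF xy(3)] by auto
  have p: "x < z" "z < y" using xy(2) far z(1) m(1,2) z(2) by (fastforce simp: nbrs_def)+
  have "\<not> strictly_between (w x) (w z) (w y)"
    using box_adj_not_between[OF xy(3) m(1)] m z p by (simp add: strictly_between_def)
  moreover have "w z \<noteq> w x" "w z \<noteq> w y"
    using oc p m xy(1) by (auto simp: odd_config_def inj_on_def)
  ultimately show ?thesis using p by (auto simp: strictly_between_def)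
qed

text \<open>
  The boxes that a point above both \<open>x\<close> and \<open>y\<close> spans with them together cover all positions between
  \<open>x\<close> and \<open>y\<close>. The lower of the two points \<open>z1\<close>, \<open>z2\<close> therefore lies in a box of the higher one, which is
  tolerated only if they are antipodal.
\<close>

lemma common_upper_neighbours:
  assumes oc: "odd_config A w"
    and pos: "x < z1" "z1 < y" "x < z2" "z2 < y"
    and up: "w z1 > max (w x) (w y)" "w z2 > max (w x) (w y)" 
    and adj: "box_adj A w x z1" "box_adj A w y z1" "box_adj A w x z2" "box_adj A w y z2"
    and ne: "z1 \<noteq> z2"
  shows "z2 = - z1"
proof (rule ccontr)
  assume "z2 \<noteq> - z1"
  then have a: "\<bar>z1\<bar> \<noteq> \<bar>z2\<bar>" using ne by auto
  have m: "z1 \<in> A" "z2 \<in> A" "\<bar>x\<bar> \<noteq> \<bar>z1\<bar>" "\<bar>x\<bar> \<noteq> \<bar>z2\<bar>" "\<bar>y\<bar> \<noteq> \<bar>z1\<bar>" "\<bar>y\<bar> \<noteq> \<bar>z2\<bar>"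
    using adj by (auto simp: box_adj_def)
  have wne: "w z1 \<noteq> w z2" using oc ne m by (auto simp: odd_config_def inj_on_def)
  have n1: "\<not> (strictly_between u p q \<and> strictly_between (w u) (w p) (w q))"
    if "box_adj A w u q" "p \<in> A" "\<bar>p\<bar> \<noteq> \<bar>u\<bar>" "\<bar>p\<bar> \<noteq> \<bar>q\<bar>" for u p q
    using box_adj_not_between[OF that(1-2)] that by blast
  show False
    using n1[OF adj(1) m(2)] n1[OF adj(2) m(2)] n1[OF adj(3) m(1)] n1[OF adj(4) m(1)] m a wne ne pos up
    unfolding strictly_between_def by (smt (verit))
qed

text \<open>
  An antipodal pair above \<open>x\<close> and \<open>y\<close> forces both to have negative values, an antipodal pair below
  forces both to be positive; so three common neighbours consist of such a pair on one side and a single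
  point on the other. The sign \<open>\<sigma>\<close> turns the picture upside down if the pair lies below, and \<open>z\<close>
  denotes the upper point of the pair after that.
\<close>

lemma common_neighbours_classification:
  assumes oc: "odd_config A w" and xy: "x \<in> A" "\<forall>a\<in>A. x \<le> a" "box_adj A w x y"
    and far: "\<forall>j\<in>nbrs A w x. j \<le> y"
  defines "C \<equiv> nbrs A w x \<inter> nbrs A w y \<inter> (A - {x, - x, y, - y})"
  assumes big: "card C > 2"
  obtains z z' \<sigma> where "\<sigma> = 1 \<or> \<sigma> = (-1::int)" "C = {z, - z, z'}" "card C = 3"
    "\<sigma> * w z > 0" "\<sigma> * w x < - \<sigma> * w z" "\<sigma> * w y < - \<sigma> * w z" 
    "\<sigma> * w z' < \<sigma> * w x" "\<sigma> * w z' < \<sigma> * w y"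
proof -
  have fC: "finite C" using finite_nbrs[OF oc] by (simp add: C_def)
  \<comment> \<open>\<open>U 1\<close> are the common neighbours above \<open>x\<close> and \<open>y\<close>, \<open>U (-1)\<close> those below.\<close>
  define U where "U \<sigma> = {z \<in> C. \<sigma> * w z > \<sigma> * w x \<and> \<sigma> * w z > \<sigma> * w y}" for \<sigma> :: int
  have loc: "x < z \<and> z < y \<and> (w z > max (w x) (w y) \<or> w z < min (w x) (w y))" if "z \<in> C" for z
    using that by (intro common_neighbour_location[OF oc xy far]) (auto simp: C_def nbrs_def)
  have oc': "odd_config A (\<lambda>k. \<sigma> * w k)" if "\<sigma> = 1 \<or> \<sigma> = -1" for \<sigma> :: int
    using that oc odd_config_value_flip[OF oc] by auto
  have adj': "box_adj A (\<lambda>k. \<sigma> * w k) i j = box_adj A w i j" if "\<sigma> = 1 \<or> \<sigma> = -1" for \<sigma> :: int and i j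
    using that box_adj_value_flip[of A w] by auto
  have opp: "b = - a" if "\<sigma> = 1 \<or> \<sigma> = -1" "a \<in> U \<sigma>" "b \<in> U \<sigma>" "a \<noteq> b" for a b \<sigma>
    using that loc[of a] loc[of b]
    by (intro common_upper_neighbours[OF oc'[OF that(1)], of x a y b])
      (auto simp: U_def adj' C_def nbrs_def)
  have un: "C = U 1 \<union> U (-1)" using loc by (auto simp: U_def)
  have disj: "U 1 \<inter> U (-1) = {}" by (auto simp: U_def)
  have cU: "card (U \<sigma>) \<le> 2" if "\<sigma> = 1 \<or> \<sigma> = -1" for \<sigma>
  proof (cases "U \<sigma> = {}")
    case False
    then obtain a where "a \<in> U \<sigma>" by blast
    then have "U \<sigma> \<subseteq> {a, - a}" using opp[OF that] by blast
    then show ?thesis using card_mono[of "{a, - a}" "U \<sigma>"] by (auto simp: card_insert_if split: if_splits)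
  qed auto
  have fU: "finite (U \<sigma>)" for \<sigma> using fC by (simp add: U_def)
  have csum: "card C = card (U 1) + card (U (-1))" using un disj fU by (simp add: card_Un_disjoint)
  have odd: "w (- a) = - w a" if "a \<in> A" for a using that oc by (simp add: odd_config_def)
  have dbl: "\<exists>z. U \<sigma> = {z, - z} \<and> \<sigma> * w z > 0 \<and> \<sigma> * w x < - \<sigma> * w z \<and> \<sigma> * w y < - \<sigma> * w z"
    if s: "\<sigma> = 1 \<or> \<sigma> = -1" and c: "card (U \<sigma>) = 2" for \<sigma>
  proof -
    obtain a b where ab: "U \<sigma> = {a, b}" "a \<noteq> b" using c by (auto simp: card_2_iff)
    then have b: "b = - a" using opp[OF s, of a b] by auto
    have aA: "a \<in> A" "a \<noteq> 0" using ab oc by (auto simp: U_def C_def odd_config_def)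
    have U: "U \<sigma> = {a, - a}" using ab b by simp
    have "w a \<noteq> w b" using oc ab aA b unfolding odd_config_def inj_on_def by metis
    then have w0: "w a \<noteq> 0" using odd[OF aA(1)] b by auto
    have "a \<in> U \<sigma>" "- a \<in> U \<sigma>" using U by auto
    then have ineq: "\<sigma> * w a > \<sigma> * w x" "\<sigma> * w a > \<sigma> * w y" "- (\<sigma> * w a) > \<sigma> * w x" "- (\<sigma> * w a) > \<sigma> * w y"
      using odd[OF aA(1)] by (auto simp: U_def)
    show ?thesis
    proof (cases "\<sigma> * w a > 0")
      case True then show ?thesis using ineq U by (intro exI[of _ a]) auto
    next
      case False
      then have "\<sigma> * w (- a) > 0" using w0 s odd[OF aA(1)] by auto
      then show ?thesis using ineq U odd[OF aA(1)] by (intro exI[of _ "- a"]) auto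
    qed
  qed
  have sgl: "\<exists>z'. U (- \<sigma>) = {z'} \<and> \<sigma> * w z' < \<sigma> * w x \<and> \<sigma> * w z' < \<sigma> * w y"
    if s: "\<sigma> = 1 \<or> \<sigma> = -1" and d: "card (U \<sigma>) = 2" for \<sigma>
  proof -
    have "card (U (- \<sigma>)) \<noteq> 2"
    proof
      assume "card (U (- \<sigma>)) = 2"
      then obtain z2 where z2: "- \<sigma> * w x < - (- \<sigma>) * w z2" "- \<sigma> * w z2 > 0" 
        using dbl[of "- \<sigma>"] s by auto
      obtain z1 where "\<sigma> * w x < - \<sigma> * w z1" "\<sigma> * w z1 > 0" using dbl[OF s d] by auto
      then show False using z2 by auto
    qed
    then have "card (U (- \<sigma>)) = 1" using big csum cU[of "- \<sigma>"] d s by auto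
    then obtain z' where "U (- \<sigma>) = {z'}" by (auto simp: card_1_singleton_iff)
    moreover from this have "z' \<in> U (- \<sigma>)" by simp
    ultimately show ?thesis by (auto simp: U_def)
  qed
  have "card (U 1) = 2 \<or> card (U (-1)) = 2" using big csum cU[of 1] cU[of "-1"] by auto
  then obtain \<sigma> where s: "\<sigma> = 1 \<or> \<sigma> = (-1::int)" "card (U \<sigma>) = 2" by auto
  obtain z where z: "U \<sigma> = {z, - z}" "\<sigma> * w z > 0" "\<sigma> * w x < - \<sigma> * w z" "\<sigma> * w y < - \<sigma> * w z" 
    using dbl[OF s] by blast
  obtain z' where z': "U (- \<sigma>) = {z'}" "\<sigma> * w z' < \<sigma> * w x" "\<sigma> * w z' < \<sigma> * w y" using sgl[OF s] by blast
  have "C = U \<sigma> \<union> U (- \<sigma>)" using un s by auto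
  then have "C = {z, - z, z'}" using z z' by auto
  moreover have "card C = 3"
    using csum s z' by auto
  ultimately show ?thesis using that s(1) z z' by blast
qed


section \<open>The exceptional configuration\<close>

text \<open>
  Here the deletion of \<open>x\<close>, \<open>y\<close> and their antipodes loses \<open>2 n + 1\<close> orbits: \<open>x\<close> is joined to both \<open>y\<close> and
  \<open>- y\<close>, there are three common neighbours, of which \<open>\<plusminus> z\<close> lie above \<open>x\<close> and \<open>y\<close> and \<open>z'\<close> below, and
  every other point is joined to \<open>x\<close> or \<open>y\<close>. As \<open>\<plusminus> z\<close> are common neighbours, every further point above \<open>x\<close> and
  \<open>y\<close> (and horizontally between them) is higher than \<open>z\<close>; if it is joined to \<open>x\<close>, it is therefore to the
  left of both \<open>z\<close> and \<open>- z\<close>, and if it is joined to \<open>y\<close>, to the right of both.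

  Suppose that some of these points are joined to \<open>x\<close>. Those form a decreasing chain towards \<open>z\<close>, and each lies to the upper left of
  \<open>- y\<close>. The last point of the chain and \<open>z\<close> are then separated by \<open>- y\<close> only, so that their box becomes empty
  when \<open>\<plusminus> y\<close> are deleted. If there are none, then the neighbours of \<open>x\<close> other than \<open>\<plusminus> y\<close>, \<open>\<plusminus> z\<close>, \<open>z'\<close> lie to the
  lower left of \<open>z'\<close>. Either there are no such neighbours either, and \<open>x\<close> has at most five neighbours, or for any
  of them, say \<open>v\<close>, no point higher than \<open>z'\<close> other than \<open>x\<close> and \<open>- y\<close> can be joined to \<open>v\<close>: on the right of
  \<open>z'\<close> the point \<open>z'\<close> obstructs, or \<open>z\<close> in the case of \<open>- z'\<close>, and on the left there are none. So \<open>v\<close> is never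
  joined to two antipodal points and has at most \<open>n\<close> neighbours.
\<close>

lemma exceptional_pair:
  assumes oc: "odd_config A w" and card: "card A = 2 * n" and n: "n \<ge> 5"
    and xA: "x \<in> A" and min: "\<forall>a\<in>A. x \<le> a"
    and xy: "box_adj A w x y" "box_adj A w x (- y)"
    and max: "\<forall>j\<in>nbrs A w x. j \<le> y"
    and C: "nbrs A w x \<inter> nbrs A w y \<inter> (A - {x, - x, y, - y}) = {z, - z, z'}"
    and up: "w z > 0" "w x < - w z" "w y < - w z"
    and dn: "w z' < w x" "w z' < w y"
    and dom: "A - {x, - x, y, - y} \<subseteq> nbrs A w x \<union> nbrs A w y"
  shows "(\<exists>v\<in>A. card (nbrs A w v) \<le> n) \<or>
    (\<exists>k l. box_adj (A - {x, - x, y, - y}) w k l \<and> \<not> box_adj A w k l)"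
proof -
  have xmin: "x \<le> a" if "a \<in> A" for a using min that by blast
  have far: "j \<le> y" if "box_adj A w x j" for j using max that by (simp add: nbrs_def)
  have cover: "box_adj A w x k \<or> box_adj A w y k" if "k \<in> A - {x, - x, y, - y}" for k
    using dom that by (auto simp: nbrs_def)
  have neg: "- a \<in> A" "a \<noteq> 0" "w (- a) = - w a" if "a \<in> A" for a
    using that oc by (auto simp: odd_config_def)
  have winj: "a = b" if "a \<in> A" "b \<in> A" "w a = w b" for a b
    using that oc by (auto simp: odd_config_def inj_on_def)
  have yA: "y \<in> A" "\<bar>y\<bar> \<noteq> \<bar>x\<bar>" using box_adj_mem[OF xy(1)] by auto
  note myA = neg(1)[OF yA(1)]
  have free: "\<not> (strictly_between u p q \<and> strictly_between (w u) (w p) (w q))"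
    if "box_adj A w u q" "p \<in> A" "\<bar>p\<bar> \<noteq> \<bar>u\<bar>" "\<bar>p\<bar> \<noteq> \<bar>q\<bar>" for u p q
    using box_adj_not_between[OF that(1-2)] that by blast
  have inC: "a \<in> A \<and> \<bar>a\<bar> \<noteq> \<bar>x\<bar> \<and> \<bar>a\<bar> \<noteq> \<bar>y\<bar> \<and> box_adj A w x a \<and> box_adj A w y a" if "a \<in> {z, - z, z'}" for a
  proof -
    have "a \<in> nbrs A w x \<inter> nbrs A w y \<inter> (A - {x, - x, y, - y})" using that C by blast
    then show ?thesis by (auto simp: nbrs_def abs_eq_iff)
  qed
  have onlyC: "a \<in> {z, - z, z'}" if "box_adj A w x a" "box_adj A w y a" for a
  proof -
    have "a \<in> nbrs A w x \<inter> nbrs A w y \<inter> (A - {x, - x, y, - y})"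
      using that box_adj_mem[OF that(1)] box_adj_mem[OF that(2)] by (auto simp: nbrs_def abs_eq_iff)
    then show ?thesis using C by blast
  qed
  have zz: "z \<in> A" "- z \<in> A" "z' \<in> A" "\<bar>z\<bar> \<noteq> \<bar>x\<bar>" "\<bar>z\<bar> \<noteq> \<bar>y\<bar>" "\<bar>z'\<bar> \<noteq> \<bar>x\<bar>" "\<bar>z'\<bar> \<noteq> \<bar>y\<bar>"
    "box_adj A w x z" "box_adj A w x (- z)" "box_adj A w x z'" 
    "box_adj A w y z" "box_adj A w y (- z)" "box_adj A w y z'"
    using inC[of z] inC[of "- z"] inC[of z'] by auto
  note loc = common_neighbour_location[OF oc xA min xy(1) max]
  have lt: "x < z" "z < y" "x < - z" "- z < y" "x < z'" "z' < y"
    using loc[of z] loc[of "- z"] loc[of z'] zz by auto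
  have zy: "\<bar>z\<bar> < y" "x < - \<bar>z\<bar>" using lt by auto
  have wz: "w (- z) = - w z" using neg zz by simp
  have zz': "\<bar>z'\<bar> \<noteq> \<bar>z\<bar>" using dn up wz by (auto simp: abs_eq_iff)
  have xy': "- x > y" "x < - y" using xmin[OF myA] yA by auto
  have strip: "w k > w x \<and> w k > w y \<or> w k < w x \<and> w k < w y"
    if "k \<in> A" "\<bar>k\<bar> \<noteq> \<bar>y\<bar>" "x < k" "k < y" for k
  proof -
    have kx: "\<bar>k\<bar> \<noteq> \<bar>x\<bar>" using that xy' by auto
    show ?thesis using free[OF xy(1) that(1) kx that(2)] that winj[OF that(1) xA] winj[OF that(1) yA(1)]
      unfolding strictly_between_def by force
  qed
  have north: "w k > w z \<and> (box_adj A w x k \<and> k < - \<bar>z\<bar> \<or> box_adj A w y k \<and> \<bar>z\<bar> < k)"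
    if k: "k \<in> A" "\<bar>k\<bar> \<noteq> \<bar>y\<bar>" "\<bar>k\<bar> \<noteq> \<bar>z\<bar>" "x < k" "k < y" "w k > w x" "w k > w y" for k
  proof -
    have kx: "\<bar>k\<bar> \<noteq> \<bar>x\<bar>" using k xy' by auto
    have wk: "w k \<noteq> w z" "w k \<noteq> w (- z)" using k winj[of k z] winj[of k "- z"] zz by auto
    have kz: "k \<noteq> z" "k \<noteq> - z" using k by auto
    have "w k > w z"
    proof (rule ccontr)
      assume "\<not> w k > w z"
      then have "w k < w z" using wk by simp
      then have "\<not> k < z" "\<not> z < k"
        using free[OF zz(8) k(1) kx k(3)] free[OF zz(11) k(1) k(2) k(3)] k(4-7)
        by (simp_all add: strictly_between_def)
      then show False using kz by simp
    qed
    moreover have "box_adj A w x k \<or> box_adj A w y k" using cover k kx by (auto simp: abs_eq_iff)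
    moreover have "k < - \<bar>z\<bar>" if a: "box_adj A w x k"
    proof -
      have "\<not> strictly_between x z k" "\<not> strictly_between x (- z) k"
        using free[OF a zz(1)] free[OF a zz(2)] zz(4,5) k(3) wz up lt calculation(1)
        by (auto simp: strictly_between_def)
      then have "k < z \<and> k < - z" using kz k(4,5) lt unfolding strictly_between_def by linarith
      then show ?thesis by linarith
    qed
    moreover have "\<bar>z\<bar> < k" if a: "box_adj A w y k"
    proof -
      have "\<not> strictly_between y z k" "\<not> strictly_between y (- z) k"
        using free[OF a zz(1)] free[OF a zz(2)] zz(4,5) k(3) wz up lt calculation(1)
        by (auto simp: strictly_between_def)
      then have "z < k \<and> - z < k" using kz k(4,5) lt unfolding strictly_between_def by linarith
      then show ?thesis by linarith
    qed
    ultimately show ?thesis by blast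
  qed
  define NX where "NX = {k \<in> A. \<bar>k\<bar> \<noteq> \<bar>y\<bar> \<and> \<bar>k\<bar> \<noteq> \<bar>z\<bar> \<and> x < k \<and> k < y \<and> w k > w x \<and> w k > w y \<and> box_adj A w x k}"
  show ?thesis
  proof (cases "NX = {}")
    case False
    have "finite NX" using oc by (simp add: NX_def odd_config_def)
    define k where "k = Max NX"
    have kN: "k \<in> NX" and kmax: "\<And>l. l \<in> NX \<Longrightarrow> l \<le> k"
      using False \<open>finite NX\<close> by (auto simp: k_def)
    have k: "k \<in> A" "\<bar>k\<bar> \<noteq> \<bar>y\<bar>" "\<bar>k\<bar> \<noteq> \<bar>z\<bar>" "x < k" "k < y" "w k > w x" "w k > w y" "box_adj A w x k"
      using kN by (auto simp: NX_def)
    have kx: "\<bar>k\<bar> \<noteq> \<bar>x\<bar>" using k xy' by auto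
    have k2: "w k > w z" "k < - \<bar>z\<bar>"
      using north[OF k(1-7)] onlyC[OF k(8)] k(3) dn up k(6) by auto
    have wy: "w (- y) = - w y" using neg yA by simp
    have ky: "k \<noteq> - y" "w k \<noteq> w (- y)" using k(2) winj[OF k(1) myA] by auto
    have f1: "\<not> (k < - y \<and> w k < w (- y))"
      using free[OF xy(2) k(1) kx] k(2,4,6) by (auto simp: strictly_between_def)
    have f2: "\<not> (- y < k \<and> w (- y) < w k)"
      using free[OF k(8) myA] k(2) yA(2) xy' wy up by (auto simp: strictly_between_def)
    have nw: "k < - y \<and> w k > - w y"
    proof (rule ccontr)
      assume "\<not> ?thesis"
      \<comment> \<open>Then \<open>- k\<close> would be a point between \<open>x\<close> and \<open>y\<close> that is neither below both nor, like all others above both, higher than \<open>z\<close>.\<close>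
      then have se: "k > - y" "w k < - w y"
        using f1 f2 ky wy by auto
      have mk: "- k \<in> A" "w (- k) = - w k" using neg k(1) by auto
      show False
        using strip[of "- k"] north[of "- k"] mk k k2 se zy xy' up by (smt (verit))
    qed
    have new: "box_adj (A - {x, - x, y, - y}) w k z"
      unfolding box_adj_def
    proof (intro conjI ballI impI notI)
      show "k \<in> A - {x, - x, y, - y}" "z \<in> A - {x, - x, y, - y}" using k kx zz by (auto simp: abs_eq_iff)
      show "\<bar>k\<bar> = \<bar>z\<bar> \<Longrightarrow> False" using k by simp
      fix l assume l: "l \<in> A - {x, - x, y, - y}" "\<bar>l\<bar> \<noteq> \<bar>k\<bar>" "\<bar>l\<bar> \<noteq> \<bar>z\<bar>"
        "strictly_between k l z" "strictly_between (w k) (w l) (w z)"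
      have ly: "\<bar>l\<bar> \<noteq> \<bar>y\<bar>" using l by (auto simp: abs_eq_iff)
      have b: "k < l" "l < z" "w z < w l" using l(4,5) k2 by (auto simp: strictly_between_def)
      have "l < - \<bar>z\<bar> \<and> box_adj A w x l"
        using north[of l] l(1,3) b k(4,6,7) k2 lt(2) zy ly up abs_ge_self[of z] by auto
      then have "l \<in> NX" using l(1,3) b k(4,6,7) k2 lt(2) ly up by (simp add: NX_def)
      then show False using kmax b by force
    qed
    have "\<not> box_adj A w k z"
    proof
      assume a: "box_adj A w k z"
      show False
        using free[OF a myA] k zz nw k2 wy up zy unfolding strictly_between_def by (smt (verit))
    qed
    then show ?thesis using new by blast
  next
    case NX: True
    have nox: "box_adj A w y k \<and> \<bar>z\<bar> < k"
      if k: "k \<in> A" "\<bar>k\<bar> \<noteq> \<bar>y\<bar>" "\<bar>k\<bar> \<noteq> \<bar>z\<bar>" "x < k" "k < y" "w k > w x" "w k > w y" for k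
      using north[OF k] k NX by (auto simp: NX_def)
    have mz': "- z' \<in> A" "w (- z') = - w z'" using neg zz by auto
    \<comment> \<open>Unless it lies beyond \<open>y\<close>, the point \<open>- z'\<close> is above \<open>x\<close> and \<open>y\<close> and not joined to \<open>x\<close>, hence to the right of \<open>\<plusminus> z\<close>.\<close>
    have cz': "z' < - \<bar>z\<bar>"
    proof (cases "- z' < y")
      case True
      have "\<bar>z\<bar> < - z'"
        using nox[of "- z'"] mz' zz zz' xy' lt True dn up by simp
      then show ?thesis by simp
    qed (use zy in auto)
    show ?thesis
    proof (cases "nbrs A w x \<subseteq> {y, - y, z, - z, z'}")
      case True
      then have "card (nbrs A w x) \<le> card {y, - y, z, - z, z'}" by (intro card_mono) auto
      also have "\<dots> \<le> 5" by (intro card_insert_le_m1) auto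
      finally show ?thesis using n xA by fastforce
    next
      case False
      then obtain v where v: "box_adj A w x v" "v \<notin> {y, - y, z, - z, z'}" by (auto simp: nbrs_def)
      have vA: "v \<in> A" "\<bar>v\<bar> \<noteq> \<bar>x\<bar>" "\<bar>v\<bar> \<noteq> \<bar>y\<bar>" "\<bar>v\<bar> \<noteq> \<bar>z\<bar>" "v \<noteq> z'"
        using box_adj_mem[OF v(1)] v(2) by (auto simp: abs_eq_iff)
      have vp: "x < v" "v < y" using xmin[OF vA(1)] far[OF v(1)] vA v(2) by fastforce+
      have vlow: "w v < w x" "w v < w y"
      proof -
        have "\<not> (w v > w x \<and> w v > w y)" using NX vA vp v(1) by (auto simp: NX_def)
        then show "w v < w x" "w v < w y" using strip[OF vA(1,3) vp] by auto
      qed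
      have vz': "v \<noteq> - z'" using mz' vlow dn up by auto
      then have vz'a: "\<bar>v\<bar> \<noteq> \<bar>z'\<bar>" using vA by (auto simp: abs_eq_iff)
      have wvz': "w v \<noteq> w z'" using winj[OF vA(1) zz(3)] vA by auto
      have sw: "v < z'" "w v < w z'"
        using free[OF zz(10) vA(1,2) vz'a] free[OF zz(13) vA(1,3) vz'a] free[OF v(1) zz(3)]
          vA zz vp vlow dn lt vz'a wvz' unfolding strictly_between_def by (smt (verit))+
      have low: "w j \<le> w z' \<or> j = x \<or> j = - y" if j: "box_adj A w v j" for j
      proof (rule ccontr)
        assume c: "\<not> ?thesis"
        have jA: "j \<in> A" "\<bar>j\<bar> \<noteq> \<bar>v\<bar>" using box_adj_mem[OF j] by auto
        have "j \<noteq> z'" using c by auto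
        show False
        proof (cases "j < z'")
          case True
          have jx: "x < j" "j < y" using c xmin[OF jA(1)] True lt by auto
          have "\<bar>j\<bar> \<noteq> \<bar>y\<bar>" "\<bar>j\<bar> \<noteq> \<bar>z\<bar>" using c jx True lt cz' by (auto simp: abs_eq_iff)
          moreover have jz': "\<bar>j\<bar> \<noteq> \<bar>z'\<bar>" using True cz' by auto
          moreover have "w j > w x \<and> w j > w y"
          proof (rule ccontr)
            assume "\<not> ?thesis"
            then have jl: "w j < w x" "w j < w y" using strip[OF jA(1)] jx calculation by auto
            have jxa: "\<bar>j\<bar> \<noteq> \<bar>x\<bar>" using jx xy' by auto
            show False 
              using free[OF zz(10) jA(1) jxa jz'] c jl jx True lt unfolding strictly_between_def by auto
          qed
          ultimately show False using nox[OF jA(1)] jx True cz' by auto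
        next
          case False
          then have jz: "j > z'" using \<open>j \<noteq> z'\<close> by simp
          have "\<bar>z'\<bar> = \<bar>j\<bar>"
            using free[OF j zz(3)] vz'a sw jz c unfolding strictly_between_def by auto
          then have jm: "j = - z'" using \<open>j \<noteq> z'\<close> by auto
          show False
            using free[OF j zz(1)] vA(4) jm zz' sw cz' mz' up dn
            by (auto simp: strictly_between_def)
        qed
      qed
      have "card (nbrs A w v) \<le> n"
      proof -
        have wneg: "w z' < 0" using dn up by simp
        have nobo: "\<not> (box_adj A w v j \<and> box_adj A w v (- j))" for j
        proof
          assume b: "box_adj A w v j \<and> box_adj A w v (- j)"
          then have jA: "j \<in> A" using box_adj_mem by blast
          have "w (- j) = - w j" using neg jA by simp
          moreover have "w (- y) = - w y" using neg yA by simp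
          ultimately show False
            using low[of j] low[of "- j"] b wneg up dn yA xy' by (smt (verit))
        qed
        have fN: "finite (nbrs A w v)" using finite_nbrs[OF oc] .
        have fA: "finite A" using oc by (simp add: odd_config_def)
        have "nbrs A w v \<inter> uminus ` nbrs A w v = {}" using nobo by (auto simp: nbrs_def)
        then have "card (nbrs A w v \<union> uminus ` nbrs A w v) = 2 * card (nbrs A w v)"
          using fN by (simp add: card_Un_disjoint card_image)
        moreover have "nbrs A w v \<union> uminus ` nbrs A w v \<subseteq> A"
          using box_adj_mem neg by (auto simp: nbrs_def)
        ultimately have "2 * card (nbrs A w v) \<le> 2 * n" using card_mono[OF fA] card by metis
        then show ?thesis by simp
      qed
      then show ?thesis using vA by blast
    qed
  qed
qed


section \<open>The maximal number of empty boxes\<close>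

lemma half_square_step: "(n::nat) \<ge> 1 \<Longrightarrow> (n - 1)\<^sup>2 div 2 + (n - 1) \<le> n\<^sup>2 div 2"
proof -
  assume "n \<ge> 1"
  then obtain m where "n = Suc m" by (cases n) auto
  then have "n\<^sup>2 = m\<^sup>2 + 1 + m * 2" by (simp add: power2_eq_square)
  then show ?thesis using \<open>n = Suc m\<close> by (simp add: div_le_mono)
qed

lemma half_square_step2: "(n::nat) \<ge> 2 \<Longrightarrow> (n - 2)\<^sup>2 div 2 + 2 * (n - 1) = n\<^sup>2 div 2"
proof -
  assume "n \<ge> 2"
  then obtain m where m: "n = m + 2" using nat_le_iff_add by (metis add.commute)
  then have "n\<^sup>2 = m\<^sup>2 + 2 * (m + 1) * 2" by (simp add: power2_eq_square)
  then show ?thesis using m by simp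
qed

text \<open>
  For \<open>n = 2\<close> the bound is \<open>3\<close>, but there are only two orbits at all. The induction needs this sharper
  value: the exceptional configuration is excluded only for \<open>n \<ge> 5\<close>, and for \<open>n = 4\<close> a loss of
  \<open>2 n + 1\<close> is affordable exactly because the remaining four points contribute at most \<open>2\<close>.
\<close>

lemma card_adj_orbits_le_aux:
  assumes "odd_config A w" "card A = 2 * n"
  shows "card (adj_orbits A w) \<le> (if n = 2 then 2 else n\<^sup>2 div 2 + n - 1)"
  using assms
proof (induction n arbitrary: A rule: less_induct)
  case (less n)
  note oc = less.prems(1) and cA = less.prems(2)
  define g where "g n = (if n = 2 then 2 else n\<^sup>2 div 2 + n - 1)" for n :: nat
  have fA: "finite A" using oc by (simp add: odd_config_def)
  have IH: "card (adj_orbits (A - S) w) \<le> g m"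
    if "m < n" "card (A - S) = 2 * m" "\<And>k. k \<in> S \<Longrightarrow> - k \<in> S" for m S
    using less.IH[OF that(1) odd_config_diff[OF oc that(3)] that(2)] by (simp add: g_def)
  have neg: "- a \<in> A" "a \<noteq> - a" if "a \<in> A" for a
    using that oc by (auto simp: odd_config_def)
  have rem1: "card (adj_orbits A w) \<le> g (n - 1) + card (nbrs A w v)" if v: "v \<in> A" and "n \<ge> 1" for v
  proof -
    have "card (A - {v, - v}) = 2 * (n - 1)"
      using neg[OF v] v cA fA by (simp add: card_Diff_subset)
    then have "card (adj_orbits (A - {v, - v}) w) \<le> g (n - 1)"
      using that by (intro IH) auto
    then show ?thesis using card_adj_orbits_remove1[OF oc, of v] by linarith
  qed
  consider "n = 0" | "n \<ge> 1" "n \<le> 3" | "n \<ge> 4" "\<exists>v\<in>A. card (nbrs A w v) \<le> n"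
    | "n \<ge> 4" "\<forall>v\<in>A. card (nbrs A w v) > n" by force
  then have "card (adj_orbits A w) \<le> g n"
  proof cases
    case 1
    then have "adj_orbits A w = {}" using cA fA by (auto simp: adj_orbits_def box_adj_def)
    then show ?thesis by simp
  next
    case 2
    then have "A \<noteq> {}" using cA by auto
    then obtain v where "v \<in> A" by blast
    then have "card (adj_orbits A w) \<le> g (n - 1) + (2 * n - 2)"
      using rem1[of v] card_nbrs_le[OF oc _ cA, of v] 2 by simp
    moreover have "n = 1 \<or> n = 2 \<or> n = 3" using 2 by auto
    ultimately show ?thesis by (auto simp: g_def)
  next
    case 3
    then obtain v where "v \<in> A" "card (nbrs A w v) \<le> n" by blast
    then have "card (adj_orbits A w) \<le> g (n - 1) + n" using rem1[of v] 3 by simp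
    moreover have "g (n - 1) = (n - 1)\<^sup>2 div 2 + (n - 1) - 1" "g n = n\<^sup>2 div 2 + n - 1"
      using 3(1) by (auto simp: g_def)
    ultimately show ?thesis using half_square_step[of n] 3(1) by linarith
  next
    case 4
    define x where "x = Min A"
    have "A \<noteq> {}" using cA 4 by auto
    then have xA: "x \<in> A" and xmin: "\<forall>a\<in>A. x \<le> a" using fA by (auto simp: x_def)
    define y where "y = Max (nbrs A w x)"
    have fN: "finite (nbrs A w x)" by (rule finite_nbrs[OF oc])
    have "nbrs A w x \<noteq> {}" using 4 xA by force
    then have xy: "box_adj A w x y" and far: "\<forall>j\<in>nbrs A w x. j \<le> y"
      using Max_in[OF fN] Max_ge[OF fN] by (auto simp: y_def nbrs_def)
    have yA: "y \<in> A" "\<bar>x\<bar> \<noteq> \<bar>y\<bar>" using box_adj_mem[OF xy] by auto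
    define S where "S = {x, - x, y, - y}"
    define C where "C = nbrs A w x \<inter> nbrs A w y \<inter> (A - S)"
    define M where "M = nbrs A w x \<inter> {y, - y}"
    define R where "R = (A - S) - (nbrs A w x \<union> nbrs A w y)"
    have fC: "finite C" "finite R" using fA by (auto simp: C_def R_def)
    have r2: "card (adj_orbits A w) + card R + 4
        \<le> card (adj_orbits (A - S) w \<inter> adj_orbits A w) + 2 * n + card C + card M"
      using card_adj_orbits_remove2[OF oc cA xA yA(1,2)] by (simp add: R_def C_def M_def S_def)
    have "S \<subseteq> A" "card S = 4"
      using neg[OF xA] neg[OF yA(1)] xA yA card_two_antipodal_pairs[of x y] by (auto simp: S_def)
    then have "card (A - S) = 2 * (n - 2)" using cA fA by (simp add: card_Diff_subset finite_subset)
    then have gB: "card (adj_orbits (A - S) w) \<le> g (n - 2)" using 4 by (intro IH) (auto simp: S_def)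
    have fB: "finite (adj_orbits (A - S) w)"
      by (intro finite_adj_orbits odd_config_diff[OF oc]) (auto simp: S_def)
    have int: "card (adj_orbits (A - S) w \<inter> adj_orbits A w) \<le> card (adj_orbits (A - S) w)"
      using fB by (intro card_mono) auto
    have M: "card M \<le> 2" "card M = 2 \<Longrightarrow> box_adj A w x (- y)"
    proof -
      have "card M \<le> card {y, - y}" unfolding M_def by (intro card_mono) auto
      also have "\<dots> \<le> 2" by (simp add: card_insert_if)
      finally show "card M \<le> 2" .
      assume "card M = 2"
      moreover have "card {y, - y} = 2" using neg(2)[OF yA(1)] by simp
      ultimately have "M = {y, - y}" by (intro card_subset_eq) (auto simp: M_def)
      then show "box_adj A w x (- y)" by (auto simp: M_def nbrs_def)
    qed
    note trichotomy = common_neighbours_classification[OF oc xA xmin xy far, folded S_def, folded C_def]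
    have C3: "card C \<le> 3"
    proof (rule ccontr)
      assume "\<not> ?thesis"
      then have "card C > 2" by simp
      then have "card C = 3" by (rule trichotomy)
      then show False using \<open>\<not> card C \<le> 3\<close> by simp
    qed
    have goal: "card (adj_orbits A w) \<le> g n" 
      if "card (adj_orbits A w) \<le> g (n - 2) + 2 * n + (if n = 4 then 1 else 0)"
    proof (cases "n = 4")
      case True then show ?thesis using that by (simp add: g_def)
    next
      case False
      then have "g (n - 2) = (n - 2)\<^sup>2 div 2 + (n - 2) - 1" "g n = n\<^sup>2 div 2 + n - 1"
        using 4(1) by (auto simp: g_def)
      moreover have "card (adj_orbits A w) \<le> g (n - 2) + 2 * n" using that False by (simp only: if_False add_0_right)
      ultimately show ?thesis using half_square_step2[of n] 4(1) by linarith
    qed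
    show ?thesis
    proof (cases "n = 4 \<or> card C \<le> 2 \<or> card M \<le> 1 \<or> R \<noteq> {}")
      case True
      then have "n = 4 \<or> card C \<le> 2 \<or> card M \<le> 1 \<or> card R \<ge> 1"
        using fC(2) by (auto simp: Suc_le_eq card_gt_0_iff)
      then show ?thesis using r2 gB int C3 M(1) by (intro goal) auto
    next
      case False
      then have F: "n \<ge> 5" "card C > 2" "card M = 2" "R = {}" using 4 M(1) by auto
      obtain z z' \<sigma> where s: "\<sigma> = 1 \<or> \<sigma> = (-1::int)" and C: "C = {z, - z, z'}" 
        and ineq: "\<sigma> * w z > 0" "\<sigma> * w x < - \<sigma> * w z" "\<sigma> * w y < - \<sigma> * w z" 
          "\<sigma> * w z' < \<sigma> * w x" "\<sigma> * w z' < \<sigma> * w y"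
        by (rule trichotomy[OF F(2)])
      have adj: "box_adj B (\<lambda>k. \<sigma> * w k) = box_adj B w" for B
        using s box_adj_value_flip[of B w] by (auto simp: fun_eq_iff)
      have nb: "nbrs A (\<lambda>k. \<sigma> * w k) = nbrs A w" by (simp add: nbrs_def adj fun_eq_iff)
      have oc': "odd_config A (\<lambda>k. \<sigma> * w k)"
        using s oc odd_config_value_flip[OF oc] by auto
      have dom: "A - S \<subseteq> nbrs A w x \<union> nbrs A w y" using F(4) by (auto simp: R_def)
      have "(\<exists>v\<in>A. card (nbrs A w v) \<le> n) \<or> (\<exists>k l. box_adj (A - S) w k l \<and> \<not> box_adj A w k l)"
        by (rule exceptional_pair[OF oc' cA F(1) xA xmin, unfolded adj nb, OF xy M(2)[OF F(3)] far,
          folded S_def, folded C_def, OF C _ _ _ _ _ dom]) (use ineq in simp_all)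
      then obtain k l where kl: "box_adj (A - S) w k l" "\<not> box_adj A w k l" using 4 by force
      have "odd_config (A - S) w" by (intro odd_config_diff[OF oc]) (auto simp: S_def)
      then have "pair_orbit k l \<in> adj_orbits (A - S) w" "pair_orbit k l \<notin> adj_orbits A w"
        using kl pair_orbit_mem_adj_orbits oc by auto
      then have "card (adj_orbits (A - S) w \<inter> adj_orbits A w) < card (adj_orbits (A - S) w)"
        using fB by (intro psubset_card_mono) auto
      then show ?thesis using r2 gB C3 F(3) by (intro goal) auto
    qed
  qed
  then show ?case by (simp add: g_def)
qed

theorem card_adj_orbits_le:
  assumes "odd_config A w" "card A = 2 * n"
  shows "card (adj_orbits A w) \<le> n\<^sup>2 div 2 + n - 1"
  using card_adj_orbits_le_aux[OF assms] by (simp split: if_splits)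


section \<open>Inversions and reflections\<close>

definition signed_range :: "nat \<Rightarrow> int set" where
  "signed_range n = {a. 1 \<le> \<bar>a\<bar> \<and> \<bar>a\<bar> \<le> int n}"

text \<open>
  The reflection of \<open>D\<^sub>n\<close> in the root \<open>e\<^sub>i - e\<^sub>j\<close>, where \<open>e\<^bsub>- i\<^esub> = - e\<^sub>i\<close>.
\<close>

definition srefl :: "int \<Rightarrow> int \<Rightarrow> int \<Rightarrow> int" where
  "srefl i j = transpose i j \<circ> transpose (- i) (- j)"

text \<open>
  The pairs \<open>(a, b)\<close> and \<open>(- b, - a)\<close> belong to the same positive root of \<open>D\<^sub>n\<close>, so each root made negative
  by \<open>w\<close> is counted twice. Keeping both pairs avoids the choice of representatives.
\<close>

definition inv_pairs :: "int set \<Rightarrow> (int \<Rightarrow> int) \<Rightarrow> (int \<times> int) set" where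
  "inv_pairs A w = {(a, b). a \<in> A \<and> b \<in> A \<and> \<bar>a\<bar> \<noteq> \<bar>b\<bar> \<and> a < b \<and> w b < w a}"

lemma srefl_apply:
  assumes "i \<noteq> 0" "j \<noteq> 0" "\<bar>i\<bar> \<noteq> \<bar>j\<bar>"
  shows "srefl i j k = (if k = i then j else if k = j then i else if k = - i then - j
    else if k = - j then - i else k)"
proof -
  have "i \<noteq> - i" "j \<noteq> - j" "i \<noteq> j" "i \<noteq> - j" "- i \<noteq> j" using assms by auto
  then show ?thesis by (auto simp: srefl_def transpose_def)
qed

lemma srefl_fixes: "\<bar>k\<bar> \<noteq> \<bar>i\<bar> \<Longrightarrow> \<bar>k\<bar> \<noteq> \<bar>j\<bar> \<Longrightarrow> srefl i j k = k"
  by (auto simp: srefl_def transpose_def)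

lemma srefl_involution:
  assumes "i \<noteq> 0" "j \<noteq> 0" "\<bar>i\<bar> \<noteq> \<bar>j\<bar>"
  shows "srefl i j (srefl i j k) = k"
proof -
  have "i \<noteq> - i" "j \<noteq> - j" "i \<noteq> j" "i \<noteq> - j" "- i \<noteq> j" using assms by auto
  then show ?thesis by (auto simp: srefl_apply[OF assms])
qed

lemma srefl_minus:
  assumes "i \<noteq> 0" "j \<noteq> 0" "\<bar>i\<bar> \<noteq> \<bar>j\<bar>"
  shows "srefl i j (- k) = - srefl i j k"
proof -
  have "i \<noteq> - i" "j \<noteq> - j" "i \<noteq> j" "i \<noteq> - j" "- i \<noteq> j" using assms by auto
  then show ?thesis by (auto simp: srefl_apply[OF assms])
qed

lemma srefl_commute: "\<bar>i\<bar> \<noteq> \<bar>j\<bar> \<Longrightarrow> srefl i j = srefl j i"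
  by (simp add: srefl_def transpose_commute)

lemma srefl_uminus:
  assumes "i \<noteq> 0" "j \<noteq> 0" "\<bar>i\<bar> \<noteq> \<bar>j\<bar>"
  shows "srefl (- i) (- j) = srefl i j"
proof
  have "i \<noteq> - i" "j \<noteq> - j" "i \<noteq> j" "i \<noteq> - j" "- i \<noteq> j" using assms by auto
  then show "srefl (- i) (- j) k = srefl i j k" for k 
    using assms by (auto simp: srefl_apply)
qed

text \<open>
  Substituting \<open>t\<close> in the inversions of \<open>w \<circ> t\<close> shows that only the pairs whose order is reversed by \<open>t\<close>
  matter: \<open>w \<circ> t\<close> gains those that \<open>w\<close> keeps in order and loses those that \<open>w\<close> inverts.
\<close>

lemma card_inv_pairs_compose:
  assumes fin: "finite A" and tA: "\<And>a. a \<in> A \<Longrightarrow> t a \<in> A" and tt: "\<And>a. t (t a) = a"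
    and tm: "\<And>a. t (- a) = - t a"
    and inj: "inj_on w A"
  defines "M \<equiv> {(a, b). a \<in> A \<and> b \<in> A \<and> \<bar>a\<bar> \<noteq> \<bar>b\<bar> \<and> a < b \<and> t b < t a}"
  shows "card (inv_pairs A (w \<circ> t)) + card {(a, b) \<in> M. w b < w a}
    = card (inv_pairs A w) + card {(a, b) \<in> M. w a < w b}"
proof -
  define R where "R = {(a, b). a \<in> A \<and> b \<in> A \<and> \<bar>a\<bar> \<noteq> \<bar>b\<bar>}"
  have fR: "finite R" by (rule finite_subset[of _ "A \<times> A"]) (use fin in \<open>auto simp: R_def\<close>)
  have abst: "\<bar>t a\<bar> = \<bar>t b\<bar> \<longleftrightarrow> \<bar>a\<bar> = \<bar>b\<bar>" for a b
    using tt tm by (metis abs_eq_iff)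
  have ti: "t a = t b \<longleftrightarrow> a = b" for a b using tt by metis
  let ?X = "{(a, b) \<in> R. a < b \<and> t a < t b \<and> w b < w a}"
  let ?Y = "{(a, b) \<in> R. b < a \<and> t a < t b \<and> w b < w a}"
  let ?U = "{(a, b) \<in> M. w a < w b}" and ?D = "{(a, b) \<in> M. w b < w a}"
  have fin': "finite ?X" "finite ?Y" "finite ?D" 
    by (rule finite_subset[OF _ fR]; auto simp: M_def R_def)+
  have "inv_pairs A (w \<circ> t) = (\<lambda>(a, b). (t a, t b)) ` (?X \<union> ?Y)"
  proof (intro equalityI subsetI)
    fix p assume "p \<in> inv_pairs A (w \<circ> t)"
    then obtain a b where p: "p = (a, b)" "a \<in> A" "b \<in> A" "\<bar>a\<bar> \<noteq> \<bar>b\<bar>" "a < b" "w (t b) < w (t a)"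
      by (auto simp: inv_pairs_def)
    have "t a \<noteq> t b" using ti p by auto
    then have "(t a, t b) \<in> ?X \<union> ?Y" using p tA tt abst[of a b] by (auto simp: R_def)
    then show "p \<in> (\<lambda>(a, b). (t a, t b)) ` (?X \<union> ?Y)"
      using p tt by (intro image_eqI[of _ _ "(t a, t b)"]) auto
  qed (use tA tt abst in \<open>auto simp: inv_pairs_def R_def\<close>)
  moreover have "inj_on (\<lambda>(a, b). (t a, t b)) (?X \<union> ?Y)" using ti by (auto simp: inj_on_def)
  ultimately have "card (inv_pairs A (w \<circ> t)) = card (?X \<union> ?Y)" by (simp add: card_image)
  also have "\<dots> = card ?X + card ?Y" using fin' by (intro card_Un_disjoint) auto
  also have "card ?Y = card ?U"
    by (rule bij_betw_same_card[of "\<lambda>(a, b). (b, a)"], rule bij_betw_byWitness[where f' = "\<lambda>(a, b). (b, a)"])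
      (auto simp: M_def R_def)
  finally have 1: "card (inv_pairs A (w \<circ> t)) = card ?X + card ?U" .
  have "inv_pairs A w = ?X \<union> ?D"
  proof (intro equalityI subsetI)
    fix p assume "p \<in> inv_pairs A w"
    then obtain a b where p: "p = (a, b)" "a \<in> A" "b \<in> A" "\<bar>a\<bar> \<noteq> \<bar>b\<bar>" "a < b" "w b < w a"
      by (auto simp: inv_pairs_def)
    moreover have "t a \<noteq> t b" using ti p by auto
    ultimately show "p \<in> ?X \<union> ?D" by (auto simp: R_def M_def)
  qed (auto simp: inv_pairs_def R_def M_def)
  moreover have "card (?X \<union> ?D) = card ?X + card ?D"
    using fin' by (intro card_Un_disjoint) (auto simp: M_def)
  ultimately show ?thesis using 1 by simp
qed

text \<open>
  Apart from \<open>(i, j)\<close> and its mirror image, the order is reversed exactly between a moved position and a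
  fixed position that lies in the way.
\<close>

lemma srefl_reversed_pairs:
  assumes ij: "i \<noteq> 0" "j \<noteq> 0" "\<bar>i\<bar> \<noteq> \<bar>j\<bar>" "i < j" and ab: "a < b" "\<bar>a\<bar> \<noteq> \<bar>b\<bar>" "a \<noteq> 0" "b \<noteq> 0"
  defines "K \<equiv> {k. i < k \<and> k < j \<and> \<bar>k\<bar> \<noteq> \<bar>i\<bar> \<and> \<bar>k\<bar> \<noteq> \<bar>j\<bar>}"
  shows "srefl i j b < srefl i j a \<longleftrightarrow> (a = i \<and> b = j) \<or> (a = - j \<and> b = - i) \<or> (a = i \<and> b \<in> K) \<or>
    (b = j \<and> a \<in> K) \<or> (b = - i \<and> - a \<in> K) \<or> (a = - j \<and> - b \<in> K)"
proof -
  have ne: "i \<noteq> - i" "j \<noteq> - j" "i \<noteq> j" "i \<noteq> - j" "- i \<noteq> j" "j \<noteq> i" "- j \<noteq> i" "j \<noteq> - i"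
    using ij by auto
  have t: "srefl i j i = j" "srefl i j j = i" "srefl i j (- i) = - j" "srefl i j (- j) = - i"
    using ne by (simp_all add: srefl_apply[OF ij(1-3)])
  have fixed: "srefl i j k = k" if "\<bar>k\<bar> \<noteq> \<bar>j\<bar>" "\<bar>k\<bar> \<noteq> \<bar>i\<bar>" for k
    using that by (simp add: srefl_fixes)
  consider "\<bar>a\<bar> = \<bar>i\<bar>" "\<bar>b\<bar> = \<bar>j\<bar>" | "\<bar>a\<bar> = \<bar>j\<bar>" "\<bar>b\<bar> = \<bar>i\<bar>" | "\<bar>a\<bar> = \<bar>i\<bar>" "\<bar>b\<bar> \<noteq> \<bar>j\<bar>" "\<bar>b\<bar> \<noteq> \<bar>i\<bar>"
    | "\<bar>a\<bar> = \<bar>j\<bar>" "\<bar>b\<bar> \<noteq> \<bar>j\<bar>" "\<bar>b\<bar> \<noteq> \<bar>i\<bar>" | "\<bar>b\<bar> = \<bar>i\<bar>" "\<bar>a\<bar> \<noteq> \<bar>j\<bar>" "\<bar>a\<bar> \<noteq> \<bar>i\<bar>"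
    | "\<bar>b\<bar> = \<bar>j\<bar>" "\<bar>a\<bar> \<noteq> \<bar>j\<bar>" "\<bar>a\<bar> \<noteq> \<bar>i\<bar>" | "\<bar>a\<bar> \<noteq> \<bar>j\<bar>" "\<bar>a\<bar> \<noteq> \<bar>i\<bar>" "\<bar>b\<bar> \<noteq> \<bar>j\<bar>" "\<bar>b\<bar> \<noteq> \<bar>i\<bar>"
    using ab(2) by metis
  then show ?thesis
  proof cases
    case 1
    then have "(a = i \<or> a = - i) \<and> (b = j \<or> b = - j)" by linarith
    then show ?thesis using ij(4) ab(1) by (elim conjE disjE; simp add: K_def ij(1-3) t ne)
  next
    case 2
    then have "(a = j \<or> a = - j) \<and> (b = i \<or> b = - i)" by linarith
    then show ?thesis using ij(4) ab(1) by (elim conjE disjE; simp add: K_def ij(1-3) t ne)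
  next
    case 3
    have d: "b \<noteq> i" "b \<noteq> - i" "b \<noteq> j" "b \<noteq> - j" using 3(2,3) by auto
    have "(a = i \<or> a = - i)" using 3(1) by linarith
    then show ?thesis using ij(4) ab(1) by (elim disjE; simp add: K_def ij(1-3) t ne d 3(2,3) fixed[of b])
  next
    case 4
    have d: "b \<noteq> i" "b \<noteq> - i" "b \<noteq> j" "b \<noteq> - j" using 4(2,3) by auto
    have "(a = j \<or> a = - j)" using 4(1) by linarith
    then show ?thesis using ij(4) ab(1) by (elim disjE; simp add: K_def ij(1-3) t ne less_minus_iff[of b i] d 4(2,3) fixed[of b])
  next
    case 5
    have d: "a \<noteq> i" "a \<noteq> - i" "a \<noteq> j" "a \<noteq> - j" using 5(2,3) by auto
    have "(b = i \<or> b = - i)" using 5(1) by linarith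
    then show ?thesis using ij(4) ab(1) by (elim disjE; simp add: K_def ij(1-3) t ne minus_less_iff[of j a] d 5(2,3) fixed[of a])
  next
    case 6
    have d: "a \<noteq> i" "a \<noteq> - i" "a \<noteq> j" "a \<noteq> - j" using 6(2,3) by auto
    have "(b = j \<or> b = - j)" using 6(1) by linarith
    then show ?thesis using ij(4) ab(1) by (elim disjE; simp add: K_def ij(1-3) t ne d 6(2,3) fixed[of a])
  next
    case 7
    then show ?thesis using ab(1) fixed[of a] fixed[of b] by (auto simp: K_def)
  qed
qed


lemma card_reversed_pairs:
  fixes i j :: int
  assumes ij: "\<bar>i\<bar> \<noteq> \<bar>j\<bar>"
    and P: "finite P" "\<And>k. k \<in> P \<Longrightarrow> \<bar>k\<bar> \<noteq> \<bar>i\<bar> \<and> \<bar>k\<bar> \<noteq> \<bar>j\<bar>"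
    and Q: "finite Q" "\<And>k. k \<in> Q \<Longrightarrow> \<bar>k\<bar> \<noteq> \<bar>i\<bar> \<and> \<bar>k\<bar> \<noteq> \<bar>j\<bar>"
  shows "card (((\<lambda>k. (i, k)) ` P \<union> (\<lambda>k. (k, j)) ` Q) \<union> ((\<lambda>k. (- k, - i)) ` P \<union> (\<lambda>k. (- j, - k)) ` Q))
    = 2 * (card P + card Q)"
proof -
  have ne: "i \<noteq> j" "i \<noteq> - j" "j \<noteq> - i" using ij by auto
  have P': "k \<noteq> j" "k \<noteq> - i" "k \<noteq> i" "k \<noteq> - j" if "k \<in> P" for k using P(2)[OF that] by auto
  have Q': "k \<noteq> j" "k \<noteq> - i" "k \<noteq> i" "k \<noteq> - j" if "k \<in> Q" for k using Q(2)[OF that] by auto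
  have 1: "card ((\<lambda>k. (i, k)) ` P \<union> (\<lambda>k. (k, j)) ` Q) = card P + card Q"
    using P(1) Q(1) P' Q' by (subst card_Un_disjoint) (auto simp: card_image inj_on_def)
  have 2: "card ((\<lambda>k. (- k, - i)) ` P \<union> (\<lambda>k. (- j, - k)) ` Q) = card P + card Q"
    using P(1) Q(1) P' Q' by (subst card_Un_disjoint) (auto simp: card_image inj_on_def)
  have "((\<lambda>k. (i, k)) ` P \<union> (\<lambda>k. (k, j)) ` Q) \<inter> ((\<lambda>k. (- k, - i)) ` P \<union> (\<lambda>k. (- j, - k)) ` Q) = {}"
    using P' Q' ne by fastforce
  then show ?thesis using 1 2 P(1) Q(1) by (subst card_Un_disjoint) auto
qed

text \<open>
  For a position \<open>k\<close> between \<open>i\<close> and \<open>j\<close> the reversed pairs \<open>(i, k)\<close> and \<open>(k, j)\<close> cannot both be inversions of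
  \<open>w\<close>, and both are in order only if the point at \<open>k\<close> lies in the box. So every point of the box contributes
  to the gain, every other point between \<open>i\<close> and \<open>j\<close> cancels out, and the pair \<open>(i, j)\<close> with its mirror image
  gives the summand \<open>2\<close>.
\<close>

lemma card_inv_pairs_srefl:
  assumes oc: "odd_config A w" and ij: "i \<in> A" "j \<in> A" "\<bar>i\<bar> \<noteq> \<bar>j\<bar>" "i < j" "w i < w j"
  shows "card (inv_pairs A w) + 2 \<le> card (inv_pairs A (w \<circ> srefl i j))"
    and "box_adj A w i j \<Longrightarrow> card (inv_pairs A (w \<circ> srefl i j)) = card (inv_pairs A w) + 2"
proof -
  have fA: "finite A" and inj: "inj_on w A" 
    and neg: "\<And>a. a \<in> A \<Longrightarrow> - a \<in> A" "\<And>a. a \<in> A \<Longrightarrow> a \<noteq> 0" "\<And>a. a \<in> A \<Longrightarrow> w (- a) = - w a"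
    using oc by (auto simp: odd_config_def)
  note nz = neg(2)[OF ij(1)] neg(2)[OF ij(2)] ij(3)
  define K where "K = {k \<in> A. i < k \<and> k < j \<and> \<bar>k\<bar> \<noteq> \<bar>i\<bar> \<and> \<bar>k\<bar> \<noteq> \<bar>j\<bar>}"
  define M where "M = {(a, b). a \<in> A \<and> b \<in> A \<and> \<bar>a\<bar> \<noteq> \<bar>b\<bar> \<and> a < b \<and> srefl i j b < srefl i j a}"
  have fK: "finite K" using fA by (simp add: K_def)
  have M: "(a, b) \<in> M \<longleftrightarrow> (a = i \<and> b = j) \<or> (a = - j \<and> b = - i) \<or> (a = i \<and> b \<in> K) \<or>
    (b = j \<and> a \<in> K) \<or> (b = - i \<and> - a \<in> K) \<or> (a = - j \<and> - b \<in> K)" (is "_ \<longleftrightarrow> ?R") for a b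
  proof
    assume "(a, b) \<in> M"
    then have ab: "a < b" "\<bar>a\<bar> \<noteq> \<bar>b\<bar>" "a \<in> A" "b \<in> A" "srefl i j b < srefl i j a" by (auto simp: M_def)
    show ?R using srefl_reversed_pairs[OF nz ij(4) ab(1,2) neg(2)[OF ab(3)] neg(2)[OF ab(4)]] ab(3-5) neg(1)
      by (auto simp: K_def)
  next
    assume R: ?R
    have ab: "a < b" "\<bar>a\<bar> \<noteq> \<bar>b\<bar>" using R ij(3,4) by (auto simp: K_def)
    have "- k \<in> A \<longleftrightarrow> k \<in> A" for k using neg(1)[of k] neg(1)[of "- k"] by auto
    then have abA: "a \<in> A" "b \<in> A" using R ij(1,2) by (auto simp: K_def)
    show "(a, b) \<in> M"
      using srefl_reversed_pairs[OF nz ij(4) ab neg(2)[OF abA(1)] neg(2)[OF abA(2)]] R ab abA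
      unfolding M_def K_def by blast
  qed
  have tA: "srefl i j a \<in> A" if "a \<in> A" for a
    using that ij neg(1) by (auto simp: srefl_apply[OF nz])
  let ?F = "\<lambda>P Q. ((\<lambda>k. (i, k)) ` P \<union> (\<lambda>k. (k, j)) ` Q) \<union> ((\<lambda>k. (- k, - i)) ` P \<union> (\<lambda>k. (- j, - k)) ` Q)"
  have cF: "card (?F P Q) = 2 * (card P + card Q)" if "P \<subseteq> K" "Q \<subseteq> K" for P Q
    using that finite_subset[OF _ fK] by (intro card_reversed_pairs ij) (auto simp: K_def)
  define P Q P' Q' where "P = {k \<in> K. w k < w i}" and "Q = {k \<in> K. w j < w k}"
    and "P' = {k \<in> K. w i < w k}" and "Q' = {k \<in> K. w k < w j}"
  have sub: "P \<subseteq> K" "Q \<subseteq> K" "P' \<subseteq> K" "Q' \<subseteq> K" by (auto simp: P_def Q_def P'_def Q'_def)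
  have wneg: "w (- k) = - w k" if "k \<in> K" for k using that neg(3) by (simp add: K_def)
  have wn: "w (- i) = - w i" "w (- j) = - w j" using neg(3) ij by auto
  have "{(a, b) \<in> M. w b < w a} = ?F P Q"
  proof (intro equalityI subsetI)
    fix p assume "p \<in> {(a, b) \<in> M. w b < w a}"
    then obtain a b where p: "p = (a, b)" "(a, b) \<in> M" "w b < w a" by blast
    from p(2) consider "a = i" "b = j" | "a = - j" "b = - i" | "a = i" "b \<in> K" | "b = j" "a \<in> K"
      | "b = - i" "- a \<in> K" | "a = - j" "- b \<in> K" unfolding M by blast
    then show "p \<in> ?F P Q"
    proof cases
      case 3 then have "b \<in> P" using p by (simp add: P_def) then show ?thesis using p 3 by blast
    next
      case 4 then have "a \<in> Q" using p by (simp add: Q_def) then show ?thesis using p 4 by blast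
    next
      case 5 
      then have "- a \<in> P" using p wneg[of "- a"] wn by (simp add: P_def)
      then have "(- (- a), - i) \<in> ?F P Q" by blast
      then show ?thesis using p 5 by simp
    next
      case 6
      then have "- b \<in> Q" using p wneg[of "- b"] wn by (simp add: Q_def)
      then have "(- j, - (- b)) \<in> ?F P Q" by blast
      then show ?thesis using p 6 by simp
    qed (use p ij wn in auto)
  next
    fix p assume "p \<in> ?F P Q"
    then show "p \<in> {(a, b) \<in> M. w b < w a}"
      using wneg wn by (auto simp: M P_def Q_def)
  qed
  then have cD: "card {(a, b) \<in> M. w b < w a} = 2 * (card P + card Q)" using cF sub by simp
  have "{(a, b) \<in> M. w a < w b} = {(i, j), (- j, - i)} \<union> ?F P' Q'"
  proof (intro equalityI subsetI)
    fix p assume "p \<in> {(a, b) \<in> M. w a < w b}"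
    then obtain a b where p: "p = (a, b)" "(a, b) \<in> M" "w a < w b" by blast
    from p(2) consider "a = i" "b = j" | "a = - j" "b = - i" | "a = i" "b \<in> K" | "b = j" "a \<in> K"
      | "b = - i" "- a \<in> K" | "a = - j" "- b \<in> K" unfolding M by blast
    then show "p \<in> {(i, j), (- j, - i)} \<union> ?F P' Q'"
    proof cases
      case 3 then have "b \<in> P'" using p by (simp add: P'_def) then show ?thesis using p 3 by blast
    next
      case 4 then have "a \<in> Q'" using p by (simp add: Q'_def) then show ?thesis using p 4 by blast
    next
      case 5 
      then have "- a \<in> P'" using p wneg[of "- a"] wn by (simp add: P'_def)
      then have "(- (- a), - i) \<in> ?F P' Q'" by blast
      then show ?thesis using p 5 by simp
    next
      case 6
      then have "- b \<in> Q'" using p wneg[of "- b"] wn by (simp add: Q'_def)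
      then have "(- j, - (- b)) \<in> ?F P' Q'" by blast
      then show ?thesis using p 6 by simp
    qed (use p in auto)
  next
    fix p assume "p \<in> {(i, j), (- j, - i)} \<union> ?F P' Q'"
    then show "p \<in> {(a, b) \<in> M. w a < w b}"
      using wneg wn ij by (auto simp: M P'_def Q'_def)
  qed
  moreover have "{(i, j), (- j, - i)} \<inter> ?F P' Q' = {}" using ij(3,4) sub by (auto simp: K_def)
  then have "card ({(i, j), (- j, - i)} \<union> ?F P' Q') = card {(i, j), (- j, - i)} + card (?F P' Q')"
    using sub finite_subset[OF _ fK] by (intro card_Un_disjoint) auto
  moreover have "card {(i, j), (- j, - i)} = 2" using ij(3) by auto
  ultimately have cU: "card {(a, b) \<in> M. w a < w b} = 2 + 2 * (card P' + card Q')"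
    using cF[OF sub(3,4)] by (simp only:)
  have main: "card (inv_pairs A (w \<circ> srefl i j)) + 2 * (card P + card Q)
    = card (inv_pairs A w) + (2 + 2 * (card P' + card Q'))"
    using card_inv_pairs_compose[OF fA tA srefl_involution[OF nz] srefl_minus[OF nz] inj, folded M_def]
    unfolding cD cU .
  have fin: "finite P'" "finite Q'" "finite P" "finite Q" using sub finite_subset[OF _ fK] by auto
  have le: "P \<subseteq> Q'" "Q \<subseteq> P'" using ij(5) by (auto simp: P_def Q_def P'_def Q'_def)
  then have "card P \<le> card Q'" "card Q \<le> card P'" using fin by (auto intro: card_mono)
  then have "card P + card Q \<le> card P' + card Q'" by simp
  then show "card (inv_pairs A w) + 2 \<le> card (inv_pairs A (w \<circ> srefl i j))" using main by simp
  assume adj: "box_adj A w i j"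
  have "P' \<subseteq> Q" "Q' \<subseteq> P"
  proof -
    have "w k < w i \<or> w j < w k" if "k \<in> K" for k
    proof -
      have k: "k \<in> A" "i < k" "k < j" "\<bar>k\<bar> \<noteq> \<bar>i\<bar>" "\<bar>k\<bar> \<noteq> \<bar>j\<bar>" using that by (auto simp: K_def)
      have "w k \<noteq> w i" "w k \<noteq> w j" using k ij inj by (auto simp: inj_on_def)
      then show ?thesis using box_adj_not_between[OF adj k(1,4,5)] k by (auto simp: strictly_between_def)
    qed
    then show "P' \<subseteq> Q" "Q' \<subseteq> P" by (fastforce simp: P_def Q_def P'_def Q'_def)+
  qed
  then have "P' = Q" "Q' = P" using le by auto
  then show "card (inv_pairs A (w \<circ> srefl i j)) = card (inv_pairs A w) + 2" using main by simp
qed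


section \<open>The even hyperoctahedral group and its length function\<close>

lemma finite_signed_range: "finite (signed_range n)"
  by (rule finite_subset[of _ "{- int n..int n}"]) (auto simp: signed_range_def)

lemma card_signed_range: "card (signed_range n) = 2 * n"
proof -
  have "signed_range n = {1..int n} \<union> {- int n..- 1}" by (auto simp: signed_range_def)
  then show ?thesis by (simp add: card_Un_disjoint)
qed

lemma signed_perm_permutes: "w \<in> signed_perms n \<Longrightarrow> w permutes signed_range n"
  by (simp add: signed_perms_def signed_range_def)

lemma signed_perm_minus:
  assumes "w \<in> signed_perms n" shows "w (- k) = - w k"
proof (cases "k \<in> signed_range n")
  case True then show ?thesis using assms by (simp add: signed_perms_def signed_range_def)
next
  case False
  then have "- k \<notin> signed_range n" by (simp add: signed_range_def)
  then show ?thesis using False signed_perm_permutes[OF assms] by (simp add: permutes_def)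
qed

lemma signed_permI:
  assumes "w permutes signed_range n" "\<And>k. w (- k) = - w k" shows "w \<in> signed_perms n"
  using assms by (simp add: signed_perms_def signed_range_def)

lemma signed_perm_inj: "w \<in> signed_perms n \<Longrightarrow> w a = w b \<longleftrightarrow> a = b"
  using permutes_inj[OF signed_perm_permutes] by (auto dest: injD)

lemma signed_perm_abs: "w \<in> signed_perms n \<Longrightarrow> \<bar>w a\<bar> = \<bar>w b\<bar> \<longleftrightarrow> \<bar>a\<bar> = \<bar>b\<bar>"
  using signed_perm_inj[of w n a b] signed_perm_inj[of w n a "- b"] signed_perm_minus[of w n b]
  by (auto simp: abs_eq_iff)

lemma signed_perm_in_range: "w \<in> signed_perms n \<Longrightarrow> w a \<in> signed_range n \<longleftrightarrow> a \<in> signed_range n"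
  using permutes_in_image[OF signed_perm_permutes] .

lemma odd_config_signed_perm:
  assumes "w \<in> signed_perms n" shows "odd_config (signed_range n) w"
  using signed_perm_minus[OF assms] signed_perm_inj[OF assms] finite_signed_range
  by (auto simp: odd_config_def inj_on_def) (auto simp: signed_range_def)

lemma signed_perm_compose:
  "u \<in> signed_perms n \<Longrightarrow> w \<in> signed_perms n \<Longrightarrow> u \<circ> w \<in> signed_perms n"
  by (intro signed_permI) (simp_all add: permutes_compose signed_perm_permutes signed_perm_minus)

lemma signed_perm_inv:
  assumes "w \<in> signed_perms n" shows "inv_into UNIV w \<in> signed_perms n"
proof (intro signed_permI)
  show p: "inv_into UNIV w permutes signed_range n" using permutes_inv[OF signed_perm_permutes[OF assms]] .
  show "inv_into UNIV w (- k) = - inv_into UNIV w k" for k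
    using permutes_inverses[OF signed_perm_permutes[OF assms]] signed_perm_minus[OF assms]
    by (metis (no_types))
qed

text \<open>
  A multiplicative form of the parity of the number of negative values; it makes the closure properties of
  \<open>D\<^sub>n\<close> immediate.
\<close>

definition sign_product :: "nat \<Rightarrow> (int \<Rightarrow> int) \<Rightarrow> int" where
  "sign_product n w = (\<Prod>i\<in>{1..int n}. sgn (w i))"

lemma sign_product_eq_power:
  assumes "w \<in> signed_perms n"
  shows "sign_product n w = (- 1) ^ card {i \<in> {1..int n}. w i < 0}"
proof -
  have "sgn (w i) = (if w i < 0 then - 1 else 1)" if "i \<in> {1..int n}" for i
  proof -
    have "w i \<in> signed_range n" using that signed_perm_in_range[OF assms, of i] by (auto simp: signed_range_def)
    then show ?thesis by (auto simp: signed_range_def sgn_if)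
  qed
  then have "sign_product n w = (\<Prod>i\<in>{1..int n}. if w i < 0 then - 1 else 1)"
    unfolding sign_product_def by (intro prod.cong) auto
  also have "\<dots> = (\<Prod>i\<in>{i \<in> {1..int n}. w i < 0}. - 1)" by (rule prod.inter_filter[symmetric]) simp
  finally show ?thesis by simp
qed

lemma even_signed_perm_iff:
  "w \<in> even_signed_perms n \<longleftrightarrow> w \<in> signed_perms n \<and> sign_product n w = 1"
proof (cases "w \<in> signed_perms n")
  case True
  then show ?thesis unfolding even_signed_perms_def using sign_product_eq_power[OF True]
    by (cases "even (card {i \<in> {1..int n}. w i < 0})") simp_all
qed (simp add: even_signed_perms_def)

lemma sign_product_compose:
  assumes u: "u \<in> signed_perms n" and w: "w \<in> signed_perms n"
  shows "sign_product n (u \<circ> w) = sign_product n u * sign_product n w"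
proof -
  have s: "sgn (u a) = sgn (u \<bar>a\<bar>) * sgn a" if "a \<noteq> 0" for a
    using that signed_perm_minus[OF u, of "\<bar>a\<bar>"] by (cases "a > 0") (auto simp: sgn_if)
  have nz: "w i \<in> signed_range n" if "i \<in> {1..int n}" for i
    using that signed_perm_in_range[OF w, of i] by (auto simp: signed_range_def)
  have "sgn ((u \<circ> w) i) = sgn (u \<bar>w i\<bar>) * sgn (w i)" if "i \<in> {1..int n}" for i
    using s[of "w i"] nz[OF that] by (auto simp: signed_range_def)
  then have "sign_product n (u \<circ> w) = (\<Prod>i\<in>{1..int n}. sgn (u \<bar>w i\<bar>) * sgn (w i))"
    unfolding sign_product_def by (intro prod.cong) auto
  also have "\<dots> = (\<Prod>i\<in>{1..int n}. sgn (u \<bar>w i\<bar>)) * sign_product n w"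
    by (simp add: prod.distrib sign_product_def)
  also have "(\<Prod>i\<in>{1..int n}. sgn (u \<bar>w i\<bar>)) = sign_product n u"
  proof -
    have inj: "inj_on (\<lambda>i. \<bar>w i\<bar>) {1..int n}"
    proof (rule inj_onI)
      fix a b assume ab: "a \<in> {1..int n}" "b \<in> {1..int n}" "\<bar>w a\<bar> = \<bar>w b\<bar>"
      have "\<bar>a\<bar> = \<bar>b\<bar>" using signed_perm_abs[OF w] ab(3) by blast
      then show "a = b" using ab by auto
    qed
    have into: "(\<lambda>i. \<bar>w i\<bar>) ` {1..int n} \<subseteq> {1..int n}" using nz by (force simp: signed_range_def)
    have "bij_betw (\<lambda>i. \<bar>w i\<bar>) {1..int n} {1..int n}"
      using endo_inj_surj[OF _ into inj] inj by (simp add: bij_betw_def)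
    then show ?thesis unfolding sign_product_def
      by (rule prod.reindex_bij_betw[of _ _ _ "\<lambda>a. sgn (u a)"])
  qed
  finally show ?thesis .
qed

lemma sign_product_id: "sign_product n id = 1"
  by (auto simp: sign_product_def intro!: prod.neutral)

lemma id_even_signed_perm: "id \<in> even_signed_perms n"
  by (simp add: even_signed_perm_iff sign_product_id signed_permI permutes_id)

lemma even_signed_perm_compose:
  "u \<in> even_signed_perms n \<Longrightarrow> w \<in> even_signed_perms n \<Longrightarrow> u \<circ> w \<in> even_signed_perms n"
  by (simp add: even_signed_perm_iff signed_perm_compose sign_product_compose)

lemma even_signed_perm_inv:
  assumes "w \<in> even_signed_perms n" shows "inv_into UNIV w \<in> even_signed_perms n"
proof -
  have w: "w \<in> signed_perms n" "sign_product n w = 1" using assms by (auto simp: even_signed_perm_iff)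
  have "w \<circ> inv_into UNIV w = id" using permutes_inv_o(1)[OF signed_perm_permutes[OF w(1)]] .
  then have "sign_product n (inv_into UNIV w) = 1"
    using sign_product_compose[OF w(1) signed_perm_inv[OF w(1)]] w(2) by (simp add: sign_product_id)
  then show ?thesis using signed_perm_inv[OF w(1)] by (simp add: even_signed_perm_iff)
qed

lemma group_D_group: "group (D_group n)"
proof (rule groupI)
  fix w assume "w \<in> carrier (D_group n)"
  then have w: "w \<in> even_signed_perms n" by (simp add: D_group_def)
  then have "inv_into UNIV w \<circ> w = id"
    using permutes_inv_o(2)[OF signed_perm_permutes[of w n]] by (simp add: even_signed_perm_iff)
  then show "\<exists>y\<in>carrier (D_group n). y \<otimes>\<^bsub>D_group n\<^esub> w = \<one>\<^bsub>D_group n\<^esub>"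
    using even_signed_perm_inv[OF w] by (auto simp: D_group_def)
qed (auto simp: D_group_def even_signed_perm_compose id_even_signed_perm o_assoc)

lemma inv_D_group:
  assumes w: "w \<in> even_signed_perms n" shows "inv\<^bsub>D_group n\<^esub> w = inv_into UNIV w"
proof (rule group.inv_equality[OF group_D_group])
  have "inv_into UNIV w \<circ> w = id"
    using w permutes_inv_o(2)[OF signed_perm_permutes[of w n]] by (simp add: even_signed_perm_iff)
  then show "inv_into UNIV w \<otimes>\<^bsub>D_group n\<^esub> w = \<one>\<^bsub>D_group n\<^esub>" by (simp add: D_group_def)
qed (use w even_signed_perm_inv in \<open>auto simp: D_group_def\<close>)

lemma srefl_even_signed_perm:
  assumes ij: "i \<in> signed_range n" "j \<in> signed_range n" "\<bar>i\<bar> \<noteq> \<bar>j\<bar>"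
  shows "srefl i j \<in> even_signed_perms n"
proof -
  have nz: "i \<noteq> 0" "j \<noteq> 0" using ij by (auto simp: signed_range_def)
  have mi: "- i \<in> signed_range n" "- j \<in> signed_range n" using ij by (auto simp: signed_range_def)
  have "srefl i j permutes signed_range n"
    unfolding srefl_def by (intro permutes_compose permutes_swap_id ij mi)
  then have sp: "srefl i j \<in> signed_perms n" by (intro signed_permI srefl_minus nz ij)
  have ne: "i \<noteq> j" "i \<noteq> - j" "j \<noteq> - i" using ij(3) by auto
  have "even (card {k \<in> {1..int n}. srefl i j k < 0})"
  proof (cases "i > 0 \<longleftrightarrow> j > 0")
    case True
    have "\<not> srefl i j k < 0" if "k \<in> {1..int n}" for k
      using that True nz ne by (auto simp: srefl_apply[OF nz ij(3)])
    then have "{k \<in> {1..int n}. srefl i j k < 0} = {}" by blast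
    then show ?thesis by (simp only: card.empty even_zero)
  next
    case False
    have "srefl i j k < 0 \<longleftrightarrow> k = \<bar>i\<bar> \<or> k = \<bar>j\<bar>" if "k > 0" for k
      using that False nz ne by (auto simp: srefl_apply[OF nz ij(3)] abs_if split: if_splits)
    then have "{k \<in> {1..int n}. srefl i j k < 0} = {\<bar>i\<bar>, \<bar>j\<bar>}"
      using ij by (auto simp: signed_range_def)
    then show ?thesis using ij(3) by simp
  qed
  then show ?thesis using sp by (simp add: even_signed_perms_def)
qed

lemma signed_perm_conjugate_srefl:
  assumes u: "u \<in> signed_perms n" and ij: "i \<noteq> 0" "j \<noteq> 0" "\<bar>i\<bar> \<noteq> \<bar>j\<bar>"
  shows "u \<circ> srefl i j = srefl (u i) (u j) \<circ> u"
proof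
  fix k
  have "u 0 = 0" using signed_perm_minus[OF u, of 0] by simp
  then have uij: "u i \<noteq> 0" "u j \<noteq> 0" "\<bar>u i\<bar> \<noteq> \<bar>u j\<bar>"
    using ij signed_perm_inj[OF u, of i 0] signed_perm_inj[OF u, of j 0] signed_perm_abs[OF u, of i j] by auto
  show "(u \<circ> srefl i j) k = (srefl (u i) (u j) \<circ> u) k"
    by (simp add: srefl_apply[OF ij] srefl_apply[OF uij] signed_perm_inj[OF u] signed_perm_minus[OF u, symmetric])
qed


text \<open>
  The generator \<open>s\<^sub>k\<close> interchanges the positions \<open>gen_left k < gen_right k\<close>. For \<open>s\<^sub>0\<close> these are \<open>- 1\<close> and \<open>2\<close>,
  and the only position between them is \<open>1\<close>, which never obstructs; so the boxes of generators are empty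
  for every \<open>w\<close>.
\<close>

definition gen_left :: "nat \<Rightarrow> int" where
  "gen_left k = (if k = 0 then - 1 else int k)"

definition gen_right :: "nat \<Rightarrow> int" where
  "gen_right k = (if k = 0 then 2 else int k + 1)"

lemma gen_left_right:
  assumes "n \<ge> 2" "k < n"
  shows "gen_left k \<in> signed_range n" "gen_right k \<in> signed_range n" "\<bar>gen_left k\<bar> \<noteq> \<bar>gen_right k\<bar>"
    "gen_left k < gen_right k"
  using assms by (auto simp: gen_left_def gen_right_def signed_range_def)

lemma D_gen_eq_srefl: "D_gen k = srefl (gen_left k) (gen_right k)"
proof (cases "k = 0")
  case True
  have "transpose 1 (- 2) \<circ> transpose (- 1) 2 = transpose (- 1) 2 \<circ> transpose 1 (- 2 :: int)"
    by (auto simp: transpose_def fun_eq_iff)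
  then show ?thesis using True by (simp add: D_gen_def srefl_def gen_left_def gen_right_def)
qed (simp add: D_gen_def srefl_def gen_left_def gen_right_def)

lemma box_adj_gen:
  assumes "n \<ge> 2" "k < n"
  shows "box_adj (signed_range n) w (gen_left k) (gen_right k)"
  using gen_left_right[OF assms]
  by (auto simp: box_adj_def gen_left_def gen_right_def strictly_between_def signed_range_def split: if_splits)

lemma D_gen_even_signed_perm:
  assumes "n \<ge> 2" "k < n" shows "D_gen k \<in> even_signed_perms n"
  using gen_left_right[OF assms] by (simp add: D_gen_eq_srefl srefl_even_signed_perm)

lemma card_inv_pairs_srefl_down:
  assumes w: "w \<in> signed_perms n" and ij: "i \<in> signed_range n" "j \<in> signed_range n" "\<bar>i\<bar> \<noteq> \<bar>j\<bar>" "i < j" "w j < w i"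
  shows "card (inv_pairs (signed_range n) (w \<circ> srefl i j)) + 2 \<le> card (inv_pairs (signed_range n) w)"
proof -
  have nz: "i \<noteq> 0" "j \<noteq> 0" using ij by (auto simp: signed_range_def)
  let ?v = "w \<circ> srefl i j"
  have v: "?v \<in> signed_perms n"
    using srefl_even_signed_perm[OF ij(1-3)] by (intro signed_perm_compose w) (simp add: even_signed_perm_iff)
  have "?v \<circ> srefl i j = w" by (simp add: fun_eq_iff srefl_involution[OF nz ij(3)])
  moreover have "?v i < ?v j" using nz ij by (simp add: srefl_apply)
  ultimately show ?thesis
    using card_inv_pairs_srefl(1)[OF odd_config_signed_perm[OF v] ij(1-4)] by simp
qed

lemma card_inv_pairs_gen:
  assumes w: "w \<in> signed_perms n" and n: "n \<ge> 2" and k: "k < n"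
  shows "w (gen_left k) < w (gen_right k) \<Longrightarrow>
      card (inv_pairs (signed_range n) (w \<circ> D_gen k)) = card (inv_pairs (signed_range n) w) + 2"
    and "w (gen_right k) < w (gen_left k) \<Longrightarrow>
      card (inv_pairs (signed_range n) (w \<circ> D_gen k)) + 2 = card (inv_pairs (signed_range n) w)"
proof -
  note g = gen_left_right[OF n k]
  have up: "card (inv_pairs (signed_range n) (u \<circ> D_gen k)) = card (inv_pairs (signed_range n) u) + 2"
    if "u \<in> signed_perms n" "u (gen_left k) < u (gen_right k)" for u
    unfolding D_gen_eq_srefl
    using that box_adj_gen[OF n k, of u] by (intro card_inv_pairs_srefl(2) odd_config_signed_perm g)
  show "w (gen_left k) < w (gen_right k) \<Longrightarrow>
      card (inv_pairs (signed_range n) (w \<circ> D_gen k)) = card (inv_pairs (signed_range n) w) + 2"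
    by (rule up[OF w])
  assume a: "w (gen_right k) < w (gen_left k)"
  have nz: "gen_left k \<noteq> 0" "gen_right k \<noteq> 0" using g by (auto simp: signed_range_def)
  let ?v = "w \<circ> D_gen k"
  have v: "?v \<in> signed_perms n"
    using D_gen_even_signed_perm[OF n k] by (intro signed_perm_compose w) (simp add: even_signed_perm_iff)
  have "?v \<circ> D_gen k = w" by (simp add: fun_eq_iff D_gen_eq_srefl srefl_involution[OF nz g(3)])
  moreover have "?v (gen_left k) < ?v (gen_right k)"
    using a nz g by (simp add: D_gen_eq_srefl srefl_apply)
  ultimately show "card (inv_pairs (signed_range n) (w \<circ> D_gen k)) + 2 = card (inv_pairs (signed_range n) w)"
    using up[OF v] by simp
qed

text \<open>
  Without descents the values increase along \<open>1, \<dots>, n\<close> and \<open>- w 1 < w 2\<close>, so at most \<open>w 1\<close> is negative;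
  parity excludes this as well, and an increasing permutation of \<open>1, \<dots>, n\<close> is the identity.
\<close>

lemma no_descent_imp_id:
  assumes w: "w \<in> even_signed_perms n" and n: "n \<ge> 2"
    and asc: "\<And>k. k < n \<Longrightarrow> w (gen_left k) < w (gen_right k)"
  shows "w = id"
proof -
  have sp: "w \<in> signed_perms n" using w by (simp add: even_signed_perm_iff)
  have rng: "1 \<le> \<bar>w k\<bar> \<and> \<bar>w k\<bar> \<le> int n" if "1 \<le> k" "k \<le> int n" for k
    using that signed_perm_in_range[OF sp, of k] by (simp add: signed_range_def)
  have step: "w (int k) < w (int (Suc k))" if "1 \<le> k" "k < n" for k
    using asc[OF that(2)] that by (simp add: gen_left_def gen_right_def add.commute)
  have 12: "w 1 < w 2" "- w 1 < w 2"
    using step[of 1] asc[of 0] n signed_perm_minus[OF sp, of 1] by (simp_all add: gen_left_def gen_right_def)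
  have pos2: "w (int k) > 0" if "2 \<le> k" "k \<le> n" for k
    using that(1,2)
  proof (induction k rule: dec_induct)
    case (step k) then show ?case using \<open>\<And>k. 1 \<le> k \<Longrightarrow> k < n \<Longrightarrow> w (int k) < w (int (Suc k))\<close>[of k] by simp
  qed (use 12 in simp)
  have "w 1 > 0"
  proof (rule ccontr)
    assume "\<not> w 1 > 0"
    then have "w 1 < 0" using rng[of 1] n by auto
    have "{i \<in> {1..int n}. w i < 0} = {1}"
    proof (intro equalityI subsetI)
      fix i assume i: "i \<in> {i \<in> {1..int n}. w i < 0}"
      then have "nat i < 2" using pos2[of "nat i"] by force
      then show "i \<in> {1}" using i by auto
    qed (use \<open>w 1 < 0\<close> n in auto)
    then show False using w by (simp add: even_signed_perms_def)
  qed
  have lower: "int k \<le> w (int k)" if "1 \<le> k" "k \<le> n" for k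
    using that
  proof (induction k rule: dec_induct)
    case (step k) then show ?case using \<open>\<And>k. 1 \<le> k \<Longrightarrow> k < n \<Longrightarrow> w (int k) < w (int (Suc k))\<close>[of k] by simp
  qed (use \<open>w 1 > 0\<close> in simp)
  have upper: "w (int k) \<le> int k" if "k \<le> n" "1 \<le> k" for k
    using that
  proof (induction k rule: inc_induct)
    case base then show ?case using rng[of "int n"] n abs_ge_self[of "w (int n)"] by simp
  next
    case (step k) then show ?case using \<open>\<And>k. 1 \<le> k \<Longrightarrow> k < n \<Longrightarrow> w (int k) < w (int (Suc k))\<close>[of k] by simp
  qed
  have fixp: "w k = k" if "1 \<le> k" "k \<le> int n" for k
  proof -
    have "1 \<le> nat k" "nat k \<le> n" "int (nat k) = k" using that by auto
    then show ?thesis using lower[of "nat k"] upper[of "nat k"] by simp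
  qed
  show ?thesis
  proof
    fix k
    consider "1 \<le> k" "k \<le> int n" | "1 \<le> - k" "- k \<le> int n" | "k \<notin> signed_range n"
      by (force simp: signed_range_def)
    then show "w k = id k"
    proof cases
      case 2 then show ?thesis using fixp[of "- k"] signed_perm_minus[OF sp, of k] by simp
    next
      case 3 then show ?thesis using signed_perm_permutes[OF sp] by (simp add: permutes_def)
    qed (use fixp in simp)
  qed
qed

lemma inv_pairs_id: "inv_pairs A id = {}"
  by (auto simp: inv_pairs_def)

lemma foldr_D_group: "foldr (\<lambda>x y. x \<otimes>\<^bsub>D_group n\<^esub> y) xs \<one>\<^bsub>D_group n\<^esub> = foldr (\<circ>) xs id"
  by (simp add: D_group_def)

lemma foldr_comp_snoc: "foldr (\<circ>) (xs @ [s]) id = foldr (\<circ>) xs id \<circ> s"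
  by (induction xs) (simp_all add: o_assoc)

lemma inv_pairs_word_le:
  assumes n: "n \<ge> 2" and "set xs \<subseteq> D_gens n"
  shows "foldr (\<circ>) xs id \<in> even_signed_perms n \<and>
    card (inv_pairs (signed_range n) (foldr (\<circ>) xs id)) \<le> 2 * length xs"
  using assms(2)
proof (induction xs rule: rev_induct)
  case Nil then show ?case by (simp add: id_even_signed_perm inv_pairs_id flip: id_def)
next
  case (snoc s xs)
  let ?w = "foldr (\<circ>) xs id"
  have "set xs \<subseteq> D_gens n" using snoc.prems by simp
  then have IH: "?w \<in> even_signed_perms n" "card (inv_pairs (signed_range n) ?w) \<le> 2 * length xs"
    using snoc.IH by blast+
  obtain k where k: "k < n" "s = D_gen k" using snoc.prems by (auto simp: D_gens_def)
  have sp: "?w \<in> signed_perms n" using IH by (simp add: even_signed_perm_iff)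
  have "gen_left k \<noteq> gen_right k" using gen_left_right(4)[OF n k(1)] by simp
  then have "?w (gen_left k) \<noteq> ?w (gen_right k)" using signed_perm_inj[OF sp] by blast
  then have "card (inv_pairs (signed_range n) (?w \<circ> s)) \<le> card (inv_pairs (signed_range n) ?w) + 2"
    using card_inv_pairs_gen[OF sp n k(1)] k(2) by (cases "?w (gen_left k) < ?w (gen_right k)") auto
  moreover have "?w \<circ> s \<in> even_signed_perms n"
    using IH k D_gen_even_signed_perm[OF n] by (auto intro: even_signed_perm_compose)
  moreover have "2 * length (xs @ [s]) = 2 * length xs + 2" by simp
  ultimately show ?case using IH(2) unfolding foldr_comp_snoc by linarith
qed

lemma ex_reduced_word:
  assumes n: "n \<ge> 2" and w: "w \<in> even_signed_perms n"
  shows "\<exists>xs. set xs \<subseteq> D_gens n \<and> foldr (\<circ>) xs id = w \<and> 2 * length xs = card (inv_pairs (signed_range n) w)"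
  using w
proof (induction "card (inv_pairs (signed_range n) w)" arbitrary: w rule: less_induct)
  case less
  show ?case
  proof (cases "w = id")
    case True
    then show ?thesis by (intro exI[of _ "[]"]) (simp add: inv_pairs_id flip: id_def)
  next
    case False
    then obtain k where k: "k < n" "\<not> w (gen_left k) < w (gen_right k)"
      using no_descent_imp_id[OF less.prems n] by blast
    have sp: "w \<in> signed_perms n" using less.prems by (simp add: even_signed_perm_iff)
    note g = gen_left_right[OF n k(1)]
    have "w (gen_left k) \<noteq> w (gen_right k)" using g(4) signed_perm_inj[OF sp] by (metis less_irrefl)
    then have c: "card (inv_pairs (signed_range n) (w \<circ> D_gen k)) + 2 = card (inv_pairs (signed_range n) w)"
      using k by (intro card_inv_pairs_gen(2)[OF sp n k(1)]) auto
    have "w \<circ> D_gen k \<in> even_signed_perms n"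
      using D_gen_even_signed_perm[OF n k(1)] less.prems by (rule even_signed_perm_compose[rotated])
    then obtain xs where xs: "set xs \<subseteq> D_gens n" "foldr (\<circ>) xs id = w \<circ> D_gen k"
      "2 * length xs = card (inv_pairs (signed_range n) (w \<circ> D_gen k))"
      using less.hyps[of "w \<circ> D_gen k"] c by auto
    have nz: "gen_left k \<noteq> 0" "gen_right k \<noteq> 0" using g by (auto simp: signed_range_def)
    have "w \<circ> D_gen k \<circ> D_gen k = w" by (simp add: fun_eq_iff D_gen_eq_srefl srefl_involution[OF nz g(3)])
    then show ?thesis using xs c k(1)
      by (intro exI[of _ "xs @ [D_gen k]"]) (auto simp: foldr_comp_snoc D_gens_def simp del: foldr_append)
  qed
qed

text \<open>
  A generator changes the number of inversion pairs by exactly two, and as long as \<open>w \<noteq> id\<close> some generator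
  lowers it.
\<close>

theorem two_cox_length:
  assumes n: "n \<ge> 2" and w: "w \<in> even_signed_perms n"
  shows "2 * cox_length (D_group n) (D_gens n) w = card (inv_pairs (signed_range n) w)"
proof -
  obtain xs where xs: "set xs \<subseteq> D_gens n" "foldr (\<circ>) xs id = w" "2 * length xs = card (inv_pairs (signed_range n) w)"
    using ex_reduced_word[OF assms] by blast
  have "cox_length (D_group n) (D_gens n) w = length xs"
    unfolding cox_length_def foldr_D_group
  proof (rule Least_equality)
    show "\<exists>ys. length ys = length xs \<and> set ys \<subseteq> D_gens n \<and> foldr (\<circ>) ys id = w" using xs by blast
    fix m assume "\<exists>ys. length ys = m \<and> set ys \<subseteq> D_gens n \<and> foldr (\<circ>) ys id = w"
    then show "length xs \<le> m" using inv_pairs_word_le[OF n] xs(3) by fastforce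
  qed
  then show ?thesis using xs by simp
qed

lemma reflections_D_group_conj:
  assumes u: "u \<in> even_signed_perms n" and ij: "i \<noteq> 0" "j \<noteq> 0" "\<bar>i\<bar> \<noteq> \<bar>j\<bar>"
    and r: "srefl i j \<in> reflections (D_group n) (D_gens n)"
  shows "srefl (u i) (u j) \<in> reflections (D_group n) (D_gens n)"
proof -
  have sp: "u \<in> signed_perms n" using u by (simp add: even_signed_perm_iff)
  interpret group "D_group n" by (rule group_D_group)
  obtain w s where ws: "w \<in> carrier (D_group n)" "s \<in> D_gens n"
    "srefl i j = w \<otimes>\<^bsub>D_group n\<^esub> s \<otimes>\<^bsub>D_group n\<^esub> inv\<^bsub>D_group n\<^esub> w"
    using r by (auto simp: reflections_def)
  have uw: "u \<circ> w \<in> even_signed_perms n" using u ws(1) by (simp add: D_group_def even_signed_perm_compose)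
  have bij: "bij u" "bij w"
    using permutes_bij[OF signed_perm_permutes] u ws(1) by (auto simp: even_signed_perm_iff D_group_def)
  have "srefl (u i) (u j) = srefl (u i) (u j) \<circ> u \<circ> inv_into UNIV u"
    using surj_f_inv_f[OF bij_is_surj[OF bij(1)]] by (simp add: fun_eq_iff)
  also have "\<dots> = u \<circ> srefl i j \<circ> inv_into UNIV u"
    by (simp add: signed_perm_conjugate_srefl[OF sp ij])
  also have "\<dots> = (u \<circ> w) \<circ> s \<circ> inv_into UNIV (u \<circ> w)"
    using ws(1) unfolding ws(3) o_inv_distrib[OF bij]
    by (simp add: D_group_def inv_D_group[unfolded D_group_def] o_assoc)
  finally show ?thesis
    using uw ws(2) by (auto simp: reflections_def D_group_def inv_D_group[unfolded D_group_def])
qed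

lemma D_gen_reflection:
  assumes "k < n" shows "D_gen k \<in> reflections (D_group n) (D_gens n)"
proof -
  have "D_gen k = id \<otimes>\<^bsub>D_group n\<^esub> D_gen k \<otimes>\<^bsub>D_group n\<^esub> inv\<^bsub>D_group n\<^esub> id"
    unfolding inv_D_group[OF id_even_signed_perm] by (simp add: D_group_def)
  moreover have "id \<in> carrier (D_group n)" "D_gen k \<in> D_gens n"
    using assms by (auto simp: D_group_def id_even_signed_perm D_gens_def)
  ultimately show ?thesis unfolding reflections_def by blast
qed

text \<open>
  Conjugation by \<open>s\<^bsub>\<bar>i\<bar> - 1\<^esub>\<close> moves \<open>i\<close> stepwise to \<open>\<plusminus> 1\<close>, and then conjugation by \<open>s\<^bsub>j - 1\<^esub>\<close> moves \<open>j\<close> to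
  \<open>2\<close>, where the reflection is a generator.
\<close>

lemma srefl_reflection_canonical:
  assumes n: "n \<ge> 2" and ij: "i \<noteq> 0" "\<bar>i\<bar> < j" "j \<le> int n"
  shows "srefl i j \<in> reflections (D_group n) (D_gens n)"
  using ij
proof (induction "nat (\<bar>i\<bar> + j)" arbitrary: i j rule: less_induct)
  case less
  have moves: "D_gen k \<in> even_signed_perms n" 
    "D_gen k l = (if l = int k then int k + 1 else if l = int k + 1 then int k
      else if l = - int k then - int k - 1 else if l = - int k - 1 then - int k else l)"
    if "1 \<le> k" "k < n" for k l
    using D_gen_even_signed_perm[OF n that(2)] that(1)
    by (simp_all add: D_gen_eq_srefl gen_left_def gen_right_def srefl_apply)
  consider "\<bar>i\<bar> = 1" "j = 2" | "\<bar>i\<bar> = 1" "j > 2" | "\<bar>i\<bar> \<ge> 2" using less.prems by linarith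
  then show ?case
  proof cases
    case 1
    then have "i = 1 \<or> i = - 1" by linarith
    then have "srefl i j = D_gen (if i = 1 then 1 else 0)"
      using 1 by (auto simp: D_gen_eq_srefl gen_left_def gen_right_def)
    then show ?thesis using D_gen_reflection n by auto
  next
    case 2
    define k where "k = nat (j - 1)"
    have k: "1 \<le> k" "k < n" "int k = j - 1" using 2 less.prems by (auto simp: k_def)
    have r: "srefl i (j - 1) \<in> reflections (D_group n) (D_gens n)"
      using 2 less.prems by (intro less.hyps) auto
    have "D_gen k i = i" using moves(2)[OF k(1,2), of i] k(3) 2 by auto
    moreover have "D_gen k (j - 1) = j" using moves(2)[OF k(1,2), of "j - 1"] k(3) by simp
    ultimately show ?thesis
      using reflections_D_group_conj[OF moves(1)[OF k(1,2)] _ _ _ r] 2 less.prems by auto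
  next
    case 3
    define k where "k = nat (\<bar>i\<bar> - 1)"
    define l where "l = i - sgn i"
    have k: "1 \<le> k" "k < n" "int k = \<bar>i\<bar> - 1" using 3 less.prems by (auto simp: k_def)
    have l: "l \<noteq> 0" "\<bar>l\<bar> = \<bar>i\<bar> - 1" using 3 by (auto simp: l_def sgn_if)
    have r: "srefl l j \<in> reflections (D_group n) (D_gens n)"
      using l less.prems by (intro less.hyps) auto
    have "D_gen k l = i" using moves(2)[OF k(1,2), of l] k(3) 3 by (auto simp: l_def sgn_if split: if_splits)
    moreover have "D_gen k j = j" using moves(2)[OF k(1,2), of j] k(3) less.prems by auto
    ultimately show ?thesis
      using reflections_D_group_conj[OF moves(1)[OF k(1,2)] _ _ _ r] l less.prems by auto
  qed
qed

lemma reflections_D_group: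
  assumes n: "n \<ge> 2"
  shows "reflections (D_group n) (D_gens n)
    = {srefl i j |i j. i \<in> signed_range n \<and> j \<in> signed_range n \<and> \<bar>i\<bar> \<noteq> \<bar>j\<bar>}" (is "_ = ?T")
proof (intro equalityI subsetI)
  fix t assume "t \<in> reflections (D_group n) (D_gens n)"
  then obtain w k where w: "w \<in> even_signed_perms n" "k < n"
    "t = w \<otimes>\<^bsub>D_group n\<^esub> D_gen k \<otimes>\<^bsub>D_group n\<^esub> inv\<^bsub>D_group n\<^esub> w"
    by (auto simp: reflections_def D_gens_def D_group_def)
  have sp: "w \<in> signed_perms n" using w by (simp add: even_signed_perm_iff)
  note g = gen_left_right[OF n w(2)]
  have nz: "gen_left k \<noteq> 0" "gen_right k \<noteq> 0" using g by (auto simp: signed_range_def)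
  have "t = w \<circ> srefl (gen_left k) (gen_right k) \<circ> inv_into UNIV w"
    using w(3) unfolding inv_D_group[OF w(1)] by (simp add: D_group_def D_gen_eq_srefl)
  also have "\<dots> = srefl (w (gen_left k)) (w (gen_right k)) \<circ> (w \<circ> inv_into UNIV w)"
    by (simp add: signed_perm_conjugate_srefl[OF sp nz g(3)] o_assoc)
  also have "\<dots> = srefl (w (gen_left k)) (w (gen_right k))"
    using permutes_inv_o(1)[OF signed_perm_permutes[OF sp]] by simp
  finally show "t \<in> ?T" using g signed_perm_in_range[OF sp] signed_perm_abs[OF sp] by blast
next
  fix t assume "t \<in> ?T"
  then obtain i j where t: "t = srefl i j" "i \<in> signed_range n" "j \<in> signed_range n" "\<bar>i\<bar> \<noteq> \<bar>j\<bar>" by blast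
  have nz: "i \<noteq> 0" "j \<noteq> 0" using t by (auto simp: signed_range_def)
  have "\<exists>a b. t = srefl a b \<and> a \<noteq> 0 \<and> \<bar>a\<bar> < b \<and> b \<le> int n"
  proof -
    consider "\<bar>i\<bar> < j" | "\<bar>i\<bar> < - j" | "\<bar>j\<bar> < i" | "\<bar>j\<bar> < - i" using t(4) by linarith
    then show ?thesis
    proof cases
      case 1 then show ?thesis using t nz by (auto simp: signed_range_def)
    next
      case 2 then show ?thesis using t nz srefl_uminus[OF nz t(4)]
        by (intro exI[of _ "- i"] exI[of _ "- j"]) (auto simp: signed_range_def)
    next
      case 3 then show ?thesis using t nz srefl_commute[OF t(4)]
        by (intro exI[of _ j] exI[of _ i]) (auto simp: signed_range_def)
    next
      case 4 then show ?thesis using t nz srefl_commute[OF t(4)] srefl_uminus[of j i]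
        by (intro exI[of _ "- j"] exI[of _ "- i"]) (auto simp: signed_range_def)
    qed
  qed
  then show "t \<in> reflections (D_group n) (D_gens n)" using srefl_reflection_canonical[OF n] by blast
qed


section \<open>Covers in the Bruhat order\<close>

lemma bruhat_step_iff:
  assumes n: "n \<ge> 2"
  shows "(u, v) \<in> bruhat_step (D_group n) (D_gens n) \<longleftrightarrow> v \<in> even_signed_perms n \<and>
    (\<exists>i j. i \<in> signed_range n \<and> j \<in> signed_range n \<and> \<bar>i\<bar> \<noteq> \<bar>j\<bar> \<and> i < j \<and> v j < v i \<and> u = v \<circ> srefl i j)"
    (is "?L \<longleftrightarrow> ?R")
proof
  assume ?L
  then obtain t where t: "t \<in> reflections (D_group n) (D_gens n)" and v: "v \<in> even_signed_perms n"
    and u: "u = t \<circ> v" and less: "cox_length (D_group n) (D_gens n) u < cox_length (D_group n) (D_gens n) v"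
    by (auto simp: bruhat_step_def D_group_def)
  have sp: "v \<in> signed_perms n" using v by (simp add: even_signed_perm_iff)
  obtain a b where ab: "t = srefl a b" "a \<in> signed_range n" "b \<in> signed_range n" "\<bar>a\<bar> \<noteq> \<bar>b\<bar>"
    using t reflections_D_group[OF n] by blast
  obtain i0 j0 where "v i0 = a" "v j0 = b"
    using permutes_surj[OF signed_perm_permutes[OF sp]] by (metis surjD)
  then have ij0: "t = srefl (v i0) (v j0)" "i0 \<in> signed_range n" "j0 \<in> signed_range n" "\<bar>i0\<bar> \<noteq> \<bar>j0\<bar>"
    using ab signed_perm_in_range[OF sp] signed_perm_abs[OF sp, of i0 j0] by auto
  have nz: "i0 \<noteq> 0" "j0 \<noteq> 0" using ij0 by (auto simp: signed_range_def)
  have u0: "u = v \<circ> srefl i0 j0" unfolding u ij0(1) signed_perm_conjugate_srefl[OF sp nz ij0(4)] ..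
  have "\<exists>i j. i \<in> signed_range n \<and> j \<in> signed_range n \<and> \<bar>i\<bar> \<noteq> \<bar>j\<bar> \<and> i < j \<and> u = v \<circ> srefl i j"
  proof (cases "i0 < j0")
    case True then show ?thesis using ij0 u0 by blast
  next
    case False
    then have "j0 < i0" using ij0(4) by (cases "i0 = j0") auto
    then show ?thesis using ij0 u0 srefl_commute[OF ij0(4)] by metis
  qed
  then obtain i j where ij: "i \<in> signed_range n" "j \<in> signed_range n" "\<bar>i\<bar> \<noteq> \<bar>j\<bar>" "i < j" "u = v \<circ> srefl i j"
    by blast
  have uD: "u \<in> even_signed_perms n"
    using ij v srefl_even_signed_perm by (simp add: even_signed_perm_compose)
  have "card (inv_pairs (signed_range n) u) < card (inv_pairs (signed_range n) v)"
    using less two_cox_length[OF n v] two_cox_length[OF n uD] by linarith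
  then have "\<not> v i < v j"
    using card_inv_pairs_srefl(1)[OF odd_config_signed_perm[OF sp] ij(1-4)] ij(5) by auto
  moreover have "v i \<noteq> v j" using signed_perm_inj[OF sp, of i j] ij(4) by simp
  ultimately show ?R using v ij by (metis linorder_neqE)
next
  assume ?R
  then obtain i j where v: "v \<in> even_signed_perms n" and ij: "i \<in> signed_range n" "j \<in> signed_range n"
    "\<bar>i\<bar> \<noteq> \<bar>j\<bar>" "i < j" "v j < v i" "u = v \<circ> srefl i j" by blast
  have sp: "v \<in> signed_perms n" using v by (simp add: even_signed_perm_iff)
  have nz: "i \<noteq> 0" "j \<noteq> 0" using ij by (auto simp: signed_range_def)
  have uD: "u \<in> even_signed_perms n"
    using ij v srefl_even_signed_perm by (simp add: even_signed_perm_compose)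
  have "srefl (v i) (v j) \<in> reflections (D_group n) (D_gens n)"
    using ij signed_perm_in_range[OF sp] signed_perm_abs[OF sp] unfolding reflections_D_group[OF n] by blast
  moreover have "u = srefl (v i) (v j) \<circ> v" using ij(6) signed_perm_conjugate_srefl[OF sp nz ij(3)] by simp
  moreover have "cox_length (D_group n) (D_gens n) u < cox_length (D_group n) (D_gens n) v"
    using card_inv_pairs_srefl_down[OF sp ij(1-5)] ij(6) two_cox_length[OF n v] two_cox_length[OF n uD]
    by simp
  ultimately show ?L using v unfolding bruhat_step_def D_group_def by auto
qed

lemma bruhat_step_carrier:
  assumes "n \<ge> 2" "(u, v) \<in> bruhat_step (D_group n) (D_gens n)"
  shows "u \<in> even_signed_perms n" "v \<in> even_signed_perms n"
  using assms(2) srefl_even_signed_perm by (auto simp: bruhat_step_iff[OF assms(1)] even_signed_perm_compose)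

lemma bruhat_less_length:
  assumes "(u, v) \<in> bruhat_less (D_group n) (D_gens n)"
  shows "cox_length (D_group n) (D_gens n) u < cox_length (D_group n) (D_gens n) v"
  using assms unfolding bruhat_less_def
proof (induction rule: trancl_induct)
  case (base y) then show ?case by (auto simp: bruhat_step_def)
next
  case (step y z)
  then have "cox_length (D_group n) (D_gens n) y < cox_length (D_group n) (D_gens n) z"
    by (auto simp: bruhat_step_def)
  then show ?case using step by simp
qed

text \<open>
  The braid relation of transpositions, which factors a reflection through a third position.
\<close>

lemma srefl_triple:
  assumes "i \<in> signed_range n" "j \<in> signed_range n" "k \<in> signed_range n" "\<bar>i\<bar> \<noteq> \<bar>j\<bar>" "\<bar>k\<bar> \<noteq> \<bar>i\<bar>" "\<bar>k\<bar> \<noteq> \<bar>j\<bar>"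
  shows "srefl i k \<circ> srefl k j \<circ> srefl i k = srefl i j"
proof -
  have nz: "i \<noteq> 0" "j \<noteq> 0" "k \<noteq> 0" using assms by (auto simp: signed_range_def)
  have ne: "k \<noteq> i" "j \<noteq> i" using assms(4,5) by auto
  have sp: "srefl i k \<in> signed_perms n"
    using srefl_even_signed_perm[OF assms(1,3)] assms(5) by (simp add: even_signed_perm_iff)
  have "srefl i k k = i" "srefl i k j = j" using nz ne assms by (auto simp: srefl_apply srefl_fixes)
  then have "srefl i k \<circ> srefl k j = srefl i j \<circ> srefl i k"
    using signed_perm_conjugate_srefl[OF sp nz(3,2)] assms(6) by simp
  then show ?thesis using nz assms(5) by (simp add: fun_eq_iff srefl_involution)
qed

text \<open>
  A point in the box gives the descending chain of values \<open>c b a\<close>, \<open>b c a\<close>, \<open>b a c\<close>, \<open>a b c\<close> at the positions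
  \<open>i\<close>, \<open>k\<close>, \<open>j\<close>, so the step from \<open>v\<close> to \<open>v \<circ> srefl i j\<close> is not a cover.
\<close>

lemma bruhat_covers_imp_box_adj:
  assumes n: "n \<ge> 2" and cov: "bruhat_covers (D_group n) (D_gens n) v u"
  shows "\<exists>i j. box_adj (signed_range n) v i j \<and> u = v \<circ> srefl i j"
proof -
  let ?less = "bruhat_less (D_group n) (D_gens n)" and ?step = "bruhat_step (D_group n) (D_gens n)"
  let ?A = "signed_range n"
  have uv: "(u, v) \<in> ?less" and no: "\<And>x. x \<in> even_signed_perms n \<Longrightarrow> (u, x) \<in> ?less \<Longrightarrow> (x, v) \<in> ?less \<Longrightarrow> False"
    using cov by (auto simp: bruhat_covers_def D_group_def)
  have "(u, v) \<in> ?step"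
    using uv unfolding bruhat_less_def
  proof (cases rule: tranclE)
    case (step x)
    then show ?thesis
      using no[of x] bruhat_step_carrier[OF n step(2)] by (auto simp: bruhat_less_def)
  qed
  then obtain i j where v: "v \<in> even_signed_perms n" and ij: "i \<in> ?A" "j \<in> ?A"
    "\<bar>i\<bar> \<noteq> \<bar>j\<bar>" "i < j" "v j < v i" "u = v \<circ> srefl i j" using bruhat_step_iff[OF n] by blast
  have "box_adj ?A v i j"
    unfolding box_adj_def
  proof (intro conjI ballI impI notI)
    fix k assume k: "k \<in> ?A" "\<bar>k\<bar> \<noteq> \<bar>i\<bar>" "\<bar>k\<bar> \<noteq> \<bar>j\<bar>" "strictly_between i k j" "strictly_between (v i) (v k) (v j)"
    have ord: "i < k" "k < j" "v j < v k" "v k < v i" using k(4,5) ij(4,5) by (auto simp: strictly_between_def)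
    have nz: "i \<noteq> 0" "j \<noteq> 0" "k \<noteq> 0" using ij k by (auto simp: signed_range_def)
    have ki: "\<bar>i\<bar> \<noteq> \<bar>k\<bar>" using k(2) by simp
    define v1 where "v1 = v \<circ> srefl i k"
    define v2 where "v2 = v1 \<circ> srefl k j"
    have v1: "v1 \<in> even_signed_perms n"
      unfolding v1_def using v srefl_even_signed_perm[OF ij(1) k(1) ki] by (rule even_signed_perm_compose)
    have v2: "v2 \<in> even_signed_perms n"
      unfolding v2_def using v1 srefl_even_signed_perm[OF k(1) ij(2) k(3)] by (rule even_signed_perm_compose)
    have u: "u = v2 \<circ> srefl i k"
      using srefl_triple[OF ij(1,2) k(1) ij(3) k(2,3)] unfolding ij(6) v2_def v1_def by (simp add: o_assoc[symmetric])
    have ne: "k \<noteq> i" "j \<noteq> i" "j \<noteq> k" "j \<noteq> - k" "j \<noteq> - i" "i \<noteq> - j" "i \<noteq> - k" "k \<noteq> - j"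
      using ij(3) k(2,3) by auto
    have val: "v1 i = v k" "v1 k = v i" "v1 j = v j" "v2 i = v k" "v2 k = v j"
      unfolding v2_def v1_def using nz ij(3) k ki ne by (simp_all add: srefl_apply srefl_fixes)
    have "(v1, v) \<in> ?step" unfolding bruhat_step_iff[OF n] using v ij k ki ord v1_def by blast
    moreover have "(v2, v1) \<in> ?step"
      unfolding bruhat_step_iff[OF n] using v1 ij k ki ord v2_def val by metis
    moreover have "(u, v2) \<in> ?step"
      unfolding bruhat_step_iff[OF n] using v2 ij k ki ord u val by metis
    ultimately have "(u, v1) \<in> ?less" "(v1, v) \<in> ?less"
      unfolding bruhat_less_def by (auto intro: trancl_trans)
    then show False using no v1 by blast
  qed (use ij in auto)
  then show ?thesis using ij by blast
qed

lemma box_adj_srefl: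
  assumes "w \<in> signed_perms n" "box_adj (signed_range n) w i j"
  shows "box_adj (signed_range n) (w \<circ> srefl i j) i j"
proof -
  have m: "i \<in> signed_range n" "j \<in> signed_range n" "\<bar>i\<bar> \<noteq> \<bar>j\<bar>" using box_adj_mem[OF assms(2)] by auto
  then have nz: "i \<noteq> 0" "j \<noteq> 0" by (auto simp: signed_range_def)
  have "i \<noteq> j" using m by auto
  then have v: "(w \<circ> srefl i j) i = w j" "(w \<circ> srefl i j) j = w i" using nz m by (auto simp: srefl_apply)
  show ?thesis
    using assms(2) m unfolding box_adj_def v by (simp add: srefl_fixes strictly_between_sym)
qed

lemma box_adj_imp_bruhat_covers:
  assumes n: "n \<ge> 2" and w: "w \<in> even_signed_perms n"
    and adj: "box_adj (signed_range n) w i j" "i < j" "w i < w j"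
  shows "bruhat_covers (D_group n) (D_gens n) (w \<circ> srefl i j) w"
proof -
  let ?v = "w \<circ> srefl i j"
  have m: "i \<in> signed_range n" "j \<in> signed_range n" "\<bar>i\<bar> \<noteq> \<bar>j\<bar>" using box_adj_mem[OF adj(1)] by auto
  have nz: "i \<noteq> 0" "j \<noteq> 0" using m by (auto simp: signed_range_def)
  have sp: "w \<in> signed_perms n" using w by (simp add: even_signed_perm_iff)
  have v: "?v \<in> even_signed_perms n"
    using w srefl_even_signed_perm[OF m] by (rule even_signed_perm_compose)
  have "i \<noteq> j" using m by auto
  then have vv: "?v i = w j" "?v j = w i" using nz m by (auto simp: srefl_apply)
  have undo: "?v \<circ> srefl i j = w" by (simp add: fun_eq_iff srefl_involution[OF nz m(3)])
  have "(w, ?v) \<in> bruhat_step (D_group n) (D_gens n)"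
    unfolding bruhat_step_iff[OF n] using v m adj vv undo by metis
  then have less: "(w, ?v) \<in> bruhat_less (D_group n) (D_gens n)" by (auto simp: bruhat_less_def)
  have "card (inv_pairs (signed_range n) ?v) = card (inv_pairs (signed_range n) w) + 2"
    by (rule card_inv_pairs_srefl(2)[OF odd_config_signed_perm[OF sp] m adj(2,3,1)])
  then have len: "cox_length (D_group n) (D_gens n) ?v = cox_length (D_group n) (D_gens n) w + 1"
    using two_cox_length[OF n v] two_cox_length[OF n w] by linarith
  show ?thesis
    unfolding bruhat_covers_def
  proof (intro conjI notI less)
    assume "\<exists>x\<in>carrier (D_group n). (w, x) \<in> bruhat_less (D_group n) (D_gens n) \<and>
      (x, ?v) \<in> bruhat_less (D_group n) (D_gens n)"
    then obtain x where "(w, x) \<in> bruhat_less (D_group n) (D_gens n)" "(x, ?v) \<in> bruhat_less (D_group n) (D_gens n)"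
      by blast
    then show False using bruhat_less_length[of w x] bruhat_less_length[of x ?v] len by fastforce
  qed
qed

theorem hasse_neighbours:
  assumes n: "n \<ge> 2" and w: "w \<in> even_signed_perms n"
  shows "{v \<in> carrier (D_group n). {w, v} \<in> hasse_edges (D_group n) (D_gens n)}
    = {w \<circ> srefl i j |i j. box_adj (signed_range n) w i j}" (is "?L = ?R")
proof (intro equalityI subsetI)
  have sp: "w \<in> signed_perms n" using w by (simp add: even_signed_perm_iff)
  fix v assume "v \<in> ?L"
  then have v: "v \<in> even_signed_perms n"
    and "bruhat_covers (D_group n) (D_gens n) v w \<or> bruhat_covers (D_group n) (D_gens n) w v"
    by (auto simp: hasse_edges_def D_group_def doubleton_eq_iff)
  then consider "bruhat_covers (D_group n) (D_gens n) v w" | "bruhat_covers (D_group n) (D_gens n) w v" by blast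
  then show "v \<in> ?R"
  proof cases
    case 1
    then obtain i j where ij: "box_adj (signed_range n) v i j" "w = v \<circ> srefl i j"
      using bruhat_covers_imp_box_adj[OF n] by blast
    have m: "i \<noteq> 0" "j \<noteq> 0" "\<bar>i\<bar> \<noteq> \<bar>j\<bar>" using box_adj_mem[OF ij(1)] by (auto simp: signed_range_def)
    have "v = w \<circ> srefl i j" unfolding ij(2) by (simp add: fun_eq_iff srefl_involution[OF m])
    moreover have "box_adj (signed_range n) w i j"
      unfolding ij(2) using v ij(1) by (intro box_adj_srefl) (simp_all add: even_signed_perm_iff)
    ultimately show ?thesis by blast
  next
    case 2
    then show ?thesis using bruhat_covers_imp_box_adj[OF n] by blast
  qed
next
  have sp: "w \<in> signed_perms n" using w by (simp add: even_signed_perm_iff)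
  fix v assume "v \<in> ?R"
  then obtain a b where ab: "box_adj (signed_range n) w a b" "v = w \<circ> srefl a b" by blast
  have "\<exists>i j. box_adj (signed_range n) w i j \<and> v = w \<circ> srefl i j \<and> i < j"
  proof (cases "a < b")
    case False
    have "\<bar>a\<bar> \<noteq> \<bar>b\<bar>" using box_adj_mem[OF ab(1)] by blast
    moreover from this have "b < a" using False by (cases "a = b") auto
    ultimately show ?thesis using ab box_adj_sym srefl_commute by metis
  qed (use ab in blast)
  then obtain i j where ij: "box_adj (signed_range n) w i j" "v = w \<circ> srefl i j" "i < j" by blast
  have m: "i \<in> signed_range n" "j \<in> signed_range n" "\<bar>i\<bar> \<noteq> \<bar>j\<bar>" using box_adj_mem[OF ij(1)] by auto
  have nz: "i \<noteq> 0" "j \<noteq> 0" using m by (auto simp: signed_range_def)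
  have v: "v \<in> even_signed_perms n"
    unfolding ij(2) using w srefl_even_signed_perm[OF m] by (rule even_signed_perm_compose)
  have "w i \<noteq> w j" using signed_perm_inj[OF sp, of i j] ij(3) by simp
  then consider "w i < w j" | "w j < w i" by linarith
  then have "bruhat_covers (D_group n) (D_gens n) v w \<or> bruhat_covers (D_group n) (D_gens n) w v"
  proof cases
    case 1 then show ?thesis using box_adj_imp_bruhat_covers[OF n w ij(1,3)] ij(2) by simp
  next
    case 2
    have undo: "v \<circ> srefl i j = w" unfolding ij(2) by (simp add: fun_eq_iff srefl_involution[OF nz m(3)])
    have "i \<noteq> j" using m by auto
    then have "v i < v j" using 2 nz m(3) by (simp add: ij(2) srefl_apply)
    then show ?thesis
      using box_adj_imp_bruhat_covers[OF n v _ ij(3)] box_adj_srefl[OF sp ij(1)] ij(2) undo by simp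
  qed
  then have "{w, v} \<in> hasse_edges (D_group n) (D_gens n)"
    unfolding hasse_edges_def using v w by (auto simp: D_group_def)
  then show "v \<in> ?L" using v by (simp add: D_group_def)
qed


section \<open>The maximal degree\<close>

lemma hasse_degree_le_card_adj_orbits:
  assumes n: "n \<ge> 2" and w: "w \<in> even_signed_perms n"
  shows "hasse_degree (D_group n) (D_gens n) w \<le> card (adj_orbits (signed_range n) w)"
proof -
  let ?A = "signed_range n"
  have oc: "odd_config ?A w" using w by (simp add: odd_config_signed_perm even_signed_perm_iff)
  define h where "h e = (let p = SOME p. pair_orbit (fst p) (snd p) = e in w \<circ> srefl (fst p) (snd p))" for e
  have "{w \<circ> srefl i j |i j. box_adj ?A w i j} \<subseteq> h ` adj_orbits ?A w"
  proof
    fix v assume "v \<in> {w \<circ> srefl i j |i j. box_adj ?A w i j}"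
    then obtain i j where ij: "box_adj ?A w i j" "v = w \<circ> srefl i j" by blast
    define p where "p = (SOME p. pair_orbit (fst p) (snd p) = pair_orbit i j)"
    have "pair_orbit (fst p) (snd p) = pair_orbit i j"
      unfolding p_def by (rule someI[of _ "(i, j)"]) simp
    then have "(fst p, snd p) \<in> {(i, j), (j, i), (- i, - j), (- j, - i)}" by (rule pair_orbit_eqD)
    moreover have m: "i \<noteq> 0" "j \<noteq> 0" "\<bar>i\<bar> \<noteq> \<bar>j\<bar>" using box_adj_mem[OF ij(1)] by (auto simp: signed_range_def)
    ultimately have "srefl (fst p) (snd p) = srefl i j"
      using srefl_uminus[OF m] srefl_uminus[OF m(2,1)] srefl_commute[OF m(3)] by auto
    then have "h (pair_orbit i j) = v" unfolding h_def p_def[symmetric] ij(2) by (simp add: Let_def)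
    moreover have "pair_orbit i j \<in> adj_orbits ?A w" using ij(1) by (auto simp: adj_orbits_def)
    ultimately show "v \<in> h ` adj_orbits ?A w" by blast
  qed
  then have "card {w \<circ> srefl i j |i j. box_adj ?A w i j} \<le> card (adj_orbits ?A w)"
    using surj_card_le[OF finite_adj_orbits[OF oc]] by blast
  then show ?thesis unfolding hasse_degree_def hasse_neighbours[OF assms] .
qed

lemma finite_even_signed_perms: "finite (even_signed_perms n)"
  by (rule finite_subset[OF _ finite_permutations[OF finite_signed_range[of n]]])
    (auto simp: even_signed_perm_iff signed_perm_permutes)

text \<open>
  With \<open>\<bar>i\<bar> < j\<close>, the position \<open>j\<close> is the largest one moved, and \<open>i\<close> is its image.
\<close>

lemma srefl_eq_imp_canonical_eq:
  assumes "i \<noteq> 0" "\<bar>i\<bar> < j" "k \<noteq> 0" "\<bar>k\<bar> < l" "srefl i j = srefl k l"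
  shows "i = k \<and> j = l"
proof -
  have nz: "j \<noteq> 0" "l \<noteq> 0" "\<bar>i\<bar> \<noteq> \<bar>j\<bar>" "\<bar>k\<bar> \<noteq> \<bar>l\<bar>" using assms by auto
  have s: "srefl i j j = i" "srefl k l l = k"
    using srefl_apply[OF assms(1) nz(1,3)] srefl_apply[OF assms(3) nz(2,4)] by auto
  have "\<not> l < j"
  proof
    assume "l < j"
    then have "srefl k l j = j" using assms by (intro srefl_fixes) auto
    then show False using s(1) assms by auto
  qed
  moreover have "\<not> j < l"
  proof
    assume "j < l"
    then have "srefl i j l = l" using assms by (intro srefl_fixes) auto
    then show False using s(2) assms by auto
  qed
  ultimately have "j = l" by simp
  then show ?thesis using s assms(5) by metis
qed

lemma card_le_hasse_degree:
  assumes n: "n \<ge> 2" and w: "w \<in> even_signed_perms n"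
    and S: "\<And>i j. (i, j) \<in> S \<Longrightarrow> box_adj (signed_range n) w i j \<and> \<bar>i\<bar> < j"
  shows "card S \<le> hasse_degree (D_group n) (D_gens n) w"
proof -
  have sp: "w \<in> signed_perms n" using w by (simp add: even_signed_perm_iff)
  have "inj_on (\<lambda>(i, j). w \<circ> srefl i j) S"
  proof (rule inj_onI, clarify)
    fix i j k l assume a: "(i, j) \<in> S" "(k, l) \<in> S" "w \<circ> srefl i j = w \<circ> srefl k l"
    have "i \<noteq> 0" "k \<noteq> 0" using S[OF a(1)] S[OF a(2)] box_adj_mem by (fastforce simp: signed_range_def)+
    moreover have "srefl i j = srefl k l"
      using fun_cong[OF a(3)] by (simp add: fun_eq_iff signed_perm_inj[OF sp])
    ultimately show "i = k \<and> j = l" using S[OF a(1)] S[OF a(2)] by (intro srefl_eq_imp_canonical_eq) auto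
  qed
  then have "card S = card ((\<lambda>(i, j). w \<circ> srefl i j) ` S)" by (rule card_image[symmetric])
  also have "\<dots> \<le> card {v \<in> carrier (D_group n). {w, v} \<in> hasse_edges (D_group n) (D_gens n)}"
  proof (rule card_mono)
    show "finite {v \<in> carrier (D_group n). {w, v} \<in> hasse_edges (D_group n) (D_gens n)}"
      using finite_even_signed_perms by (simp add: D_group_def)
    show "(\<lambda>(i, j). w \<circ> srefl i j) ` S \<subseteq> {v \<in> carrier (D_group n). {w, v} \<in> hasse_edges (D_group n) (D_gens n)}"
      unfolding hasse_neighbours[OF n w] using S by fast
  qed
  finally show ?thesis by (simp add: hasse_degree_def)
qed

text \<open>
  Up to the sign at \<open>\<plusminus> 1\<close>, the points at \<open>- m, \<dots>, m\<close> form a decreasing chain through the origin, and the points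
  beyond \<open>m\<close> form a decreasing block at the upper right. The sign at \<open>\<plusminus> 1\<close> adjusts the parity.
\<close>

definition extremal_perm :: "nat \<Rightarrow> nat \<Rightarrow> int \<Rightarrow> int" where
  "extremal_perm n m k =
    (if \<bar>k\<bar> = 1 then (if odd m then k else - k)
     else if \<bar>k\<bar> \<le> int m then - k
     else if int m < k \<and> k \<le> int n then int n + int m + 1 - k
     else if int m < - k \<and> - k \<le> int n then - (int n + int m + 1) - k
     else k)"

lemma extremal_perm_even_signed:
  assumes m: "1 \<le> m" "m \<le> n"
  shows "extremal_perm n m \<in> even_signed_perms n"
proof -
  let ?w = "extremal_perm n m"
  have invol: "?w (?w k) = k" for k using m by (auto simp: extremal_perm_def)
  have fixes_out: "?w k = k" if "k \<notin> signed_range n" for k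
    using that m by (auto simp: extremal_perm_def signed_range_def)
  have "?w permutes signed_range n"
    unfolding permutes_def using invol fixes_out by metis
  then have sp: "?w \<in> signed_perms n" by (rule signed_permI) (use m in \<open>auto simp: extremal_perm_def\<close>)
  have "{i \<in> {1..int n}. ?w i < 0} = {2..int m} \<union> (if odd m then {} else {1})"
    using m by (auto simp: extremal_perm_def split: if_splits)
  moreover have "card ({2..int m} \<union> (if odd m then {} else {1})) = (if odd m then m - 1 else m)"
    using m by (auto simp: card_Un_disjoint)
  ultimately have "even (card {i \<in> {1..int n}. ?w i < 0})" using m by simp
  then show ?thesis using sp by (simp add: even_signed_perms_def)
qed

lemma box_adj_extremal:
  assumes m: "1 \<le> m" and ij: "1 \<le> \<bar>i\<bar>" "\<bar>i\<bar> \<le> int m" "int m < j" "j \<le> int n"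
  shows "box_adj (signed_range n) (extremal_perm n m) i j"
  unfolding box_adj_def
proof (intro conjI ballI impI notI)
  show "i \<in> signed_range n" "j \<in> signed_range n" "\<bar>i\<bar> = \<bar>j\<bar> \<Longrightarrow> False"
    using ij by (auto simp: signed_range_def)
  let ?w = "extremal_perm n m"
  fix k assume k: "k \<in> signed_range n" "\<bar>k\<bar> \<noteq> \<bar>i\<bar>" "\<bar>k\<bar> \<noteq> \<bar>j\<bar>" "strictly_between i k j"
    "strictly_between (?w i) (?w k) (?w j)"
  have wj: "?w j = int n + int m + 1 - j" using ij m by (simp add: extremal_perm_def)
  have wi: "\<bar>?w i\<bar> \<le> int m" using ij m by (simp add: extremal_perm_def)
  have p: "i < k" "k < j" using k(4) ij by (auto simp: strictly_between_def)
  have v: "?w i < ?w k" "?w k < ?w j" using k(5) wi wj ij by (auto simp: strictly_between_def)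
  have "\<bar>k\<bar> \<le> int m"
  proof (rule ccontr)
    assume "\<not> ?thesis"
    then have "int m < k" using p ij by linarith
    then have "?w k = int n + int m + 1 - k" using p ij m by (simp add: extremal_perm_def)
    then show False using v wj p by simp
  qed
  then show False using v(1) p(1) k(1,2) ij(1,2) by (auto simp: extremal_perm_def signed_range_def split: if_splits)
qed

text \<open>
  The \<open>2 m\<close> points of the chain span empty boxes with the \<open>n - m\<close> points of the block; the further
  neighbours are given by the generators, among which \<open>s\<^sub>m\<close> has been counted already.
\<close>

lemma extremal_degree:
  assumes m: "2 \<le> m" "m \<le> n"
  shows "2 * m * (n - m) + (n - 1) \<le> hasse_degree (D_group n) (D_gens n) (extremal_perm n m)"
proof -
  have n: "n \<ge> 2" using m by simp
  define S1 where "S1 = signed_range m \<times> {int m<..int n}"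
  define S2 where "S2 = (\<lambda>k. (gen_left k, gen_right k)) ` ({..<n} - {m})"
  have gl: "\<bar>gen_left k\<bar> < gen_right k" for k by (auto simp: gen_left_def gen_right_def)
  have "card S1 = 2 * m * (n - m)"
    using m by (simp add: S1_def card_cartesian_product card_signed_range nat_diff_distrib)
  moreover have "card S2 = card ({..<n} - {m})"
    unfolding S2_def by (intro card_image) (auto simp: inj_on_def gen_left_def gen_right_def split: if_splits)
  moreover have "card ({..<n} - {m}) \<ge> n - 1" by (simp add: card_Diff_singleton_if)
  moreover have "S1 \<inter> S2 = {}"
    using m by (auto simp: S1_def S2_def gen_left_def gen_right_def signed_range_def split: if_splits)
  moreover have "finite S1" "finite S2" by (auto simp: S1_def S2_def finite_signed_range)
  ultimately have "2 * m * (n - m) + (n - 1) \<le> card (S1 \<union> S2)" by (simp add: card_Un_disjoint)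
  also have "\<dots> \<le> hasse_degree (D_group n) (D_gens n) (extremal_perm n m)"
  proof (rule card_le_hasse_degree[OF n])
    show "extremal_perm n m \<in> even_signed_perms n" using m by (intro extremal_perm_even_signed) auto
    fix i j assume "(i, j) \<in> S1 \<union> S2"
    then show "box_adj (signed_range n) (extremal_perm n m) i j \<and> \<bar>i\<bar> < j"
    proof
      assume "(i, j) \<in> S1"
      then show ?thesis using m box_adj_extremal[of m i j n] by (auto simp: S1_def signed_range_def)
    next
      assume "(i, j) \<in> S2"
      then show ?thesis using box_adj_gen[OF n] gl by (auto simp: S2_def)
    qed
  qed
  finally show ?thesis .
qed

lemma twice_balanced_product:
  fixes n :: nat
  defines "m \<equiv> (n + 1) div (2::nat)"
  shows "2 * m * (n - m) = n\<^sup>2 div 2"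
proof (cases "even n")
  case True
  then obtain p where "n = 2 * p" by (elim evenE)
  then show ?thesis by (simp add: m_def power2_eq_square)
next
  case False
  then obtain p where p: "n = 2 * p + 1" by (elim oddE)
  then have "n\<^sup>2 = 1 + 2 * (2 * (p + 1) * p)" by (simp add: power2_eq_square algebra_simps)
  then have "n\<^sup>2 div 2 = 2 * (p + 1) * p" by simp
  then show ?thesis using p by (simp add: m_def)
qed

theorem theorem35:
  fixes n :: nat
  assumes "n \<ge> 3"
  shows "hasse_max_degree (D_group n) (D_gens n) = n\<^sup>2 div 2 + n - 1"
proof -
  define m where "m = (n + 1) div 2"
  have n: "n \<ge> 2" and m: "2 \<le> m" "m \<le> n" using assms by (auto simp: m_def)
  let ?deg = "hasse_degree (D_group n) (D_gens n)"
  have carrier: "carrier (D_group n) = even_signed_perms n" by (simp add: D_group_def)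
  have upper: "?deg w \<le> n\<^sup>2 div 2 + n - 1" if "w \<in> even_signed_perms n" for w
  proof -
    have "odd_config (signed_range n) w" using that by (simp add: odd_config_signed_perm even_signed_perm_iff)
    then have "card (adj_orbits (signed_range n) w) \<le> n\<^sup>2 div 2 + n - 1"
      using card_signed_range by (rule card_adj_orbits_le)
    then show ?thesis using hasse_degree_le_card_adj_orbits[OF n that] by simp
  qed
  have ext: "extremal_perm n m \<in> even_signed_perms n" using m by (intro extremal_perm_even_signed) auto
  have "n\<^sup>2 div 2 + n - 1 \<le> ?deg (extremal_perm n m)"
    using extremal_degree[OF m] twice_balanced_product[of n] n unfolding m_def by simp
  then have "?deg (extremal_perm n m) = n\<^sup>2 div 2 + n - 1" using upper[OF ext] by simp
  then show ?thesis
    unfolding hasse_max_degree_def carrier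
    using finite_even_signed_perms upper ext by (intro Max_eqI) force+
qed

end
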